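(* Let $G$ be a group. Then $\mathcal{P}(G)$ is outerplanar if and only if $\mathcal{P}(G)$ is a ring graph, and $\mathcal{P}^*(G)$ is outerplanar if and only if $\mathcal{P}^*(G)$ is a ring graph.
   Context: The power graph $\mathcal{P}(G)$ of a group $G$ is the simple graph with vertex set $G$ in which two distinct vertices $x,y$ are adjacent if and only if $x\in\langle y\rangle$ or $y\in\langle x\rangle$. The proper power graph $\mathcal{P}^*(G)$ is obtained from $\mathcal{P}(G)$ by deleting the identity element. A graph is outerplanar if it has a planar embedding in which all its vertices lie on a simple closed curve, say a circle; equivalently (the criterion recalled in the paper) it contains no subdivision of $K_4$ or $K_{2,3}$ as a subgraph. A chord of a cycle in a graph is an edge of the graph joining two vertices of the cycle that are not adjacent in the cycle; a cycle with no chord is a primitive cycle. A graph $\Gamma$ satisfies the primitive cycle property (PCP) if any two (distinct) primitive cycles intersect in at most one edge. The free rank $\mathrm{frank}(\Gamma)$ is the number of primitive cycles of $\Gamma$, and the cycle rank is $\mathrm{rank}(\Gamma)=e-v+c$, where $v,e,c$ are the numbers of vertices, edges and connected components. A graph $\Gamma$ is a ring graph if one of the following equivalent conditions holds: $\mathrm{rank}(\Gamma)=\mathrm{frank}(\Gamma)$; or $\Gamma$ satisfies the PCP and does not contain a subdivision of $K_4$ as a subgraph. *)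

theory Defs
  imports
    "HOL-Algebra.Generated_Groups"
    "Graph_Theory.Kuratowski"
    "HOL-Analysis.Path_Connected"
begin

text \<open>
  As in \<^theory>\<open>Graph_Theory.Kuratowski\<close>, a simple graph is a symmetric loop-free digraph without
  parallel arcs: an undirected edge \<open>{u, v}\<close> is the pair of arcs \<open>(u, v)\<close> and \<open>(v, u)\<close>. Vertex sets
  may be infinite.
\<close>

definition power_graph :: "('a, 'm) monoid_scheme \<Rightarrow> ('a, 'a \<times> 'a) pre_digraph" where
  "power_graph G = with_proj \<lparr>
     pverts = carrier G,
     parcs = {(x, y) \<in> carrier G \<times> carrier G.
       x \<noteq> y \<and> (x \<in> generate G {y} \<or> y \<in> generate G {x})} \<rparr>"

definition proper_power_graph :: "('a, 'm) monoid_scheme \<Rightarrow> ('a, 'a \<times> 'a) pre_digraph" where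
  "proper_power_graph G = pre_digraph.del_vert (power_graph G) \<one>\<^bsub>G\<^esub>"

lemma simple_graph_power_graph:
  "sym_digraph (power_graph G)" "loopfree_digraph (power_graph G)" "nomulti_digraph (power_graph G)"
  by unfold_locales
    (auto simp: power_graph_def symmetric_def arc_to_ends_def intro!: symI)

lemma simple_graph_proper_power_graph:
  "sym_digraph (proper_power_graph G)" "loopfree_digraph (proper_power_graph G)"
  "nomulti_digraph (proper_power_graph G)"
  by unfold_locales
    (auto simp: proper_power_graph_def power_graph_def pre_digraph.del_vert_def symmetric_conv
      arc_to_ends_def)

definition edges :: "('a, 'b) pre_digraph \<Rightarrow> 'a set set" where
  "edges G = {{u, v} | u v. u \<rightarrow>\<^bsub>G\<^esub> v}"


section \<open>Outerplanar graphs\<close>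

definition planar_embedding ::
    "('a, 'b) pre_digraph \<Rightarrow> ('a \<Rightarrow> complex) \<Rightarrow> ('a set \<Rightarrow> real \<Rightarrow> complex) \<Rightarrow> bool" where
  "planar_embedding G p \<gamma> \<longleftrightarrow>
     inj_on p (verts G) \<and>
     (\<forall>e \<in> edges G. Path_Connected.arc (\<gamma> e) \<and>
        {pathstart (\<gamma> e), pathfinish (\<gamma> e)} = p ` e \<and>
        path_image (\<gamma> e) \<inter> p ` verts G = p ` e) \<and>
     (\<forall>e \<in> edges G. \<forall>f \<in> edges G. e \<noteq> f \<longrightarrow>
        path_image (\<gamma> e) \<inter> path_image (\<gamma> f) = p ` (e \<inter> f))"

text \<open>
  All vertices lie on a circle, and the edges are drawn in the closed disc that it bounds. Without
  the latter every finite planar graph would qualify, since any finite set of points in the plane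
  lies on a simple closed curve.
\<close>

definition outerplanar_embedding ::
    "('a, 'b) pre_digraph \<Rightarrow> ('a \<Rightarrow> complex) \<Rightarrow> ('a set \<Rightarrow> real \<Rightarrow> complex) \<Rightarrow> bool" where
  "outerplanar_embedding G p \<gamma> \<longleftrightarrow>
     planar_embedding G p \<gamma> \<and>
     p ` verts G \<subseteq> sphere 0 1 \<and>
     (\<forall>e \<in> edges G. path_image (\<gamma> e) \<subseteq> cball 0 1)"

text \<open>
  A finite graph is outerplanar iff it has an outerplanar embedding (lemma
  \<open>outerplanar_iff_embedding\<close> below). For an infinite graph we ask this of its finite subgraphs.
  This is the reading under which outerplanarity is equivalent to having no subdivision of the
  complete graph on 4 vertices or of the complete bipartite graph on 2 + 3 vertices as a subgraph,
  as subdivisions of finite graphs are finite. A single embedding of the whole graph would in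
  addition bound its cardinality: for instance, the plane does not contain uncountably many
  triangles with pairwise disjoint interiors, so the power graph of an uncountable group of
  exponent 3 has no outerplanar embedding, although it consists of triangles sharing one vertex.
\<close>

definition outerplanar :: "('a, 'b) pre_digraph \<Rightarrow> bool" where
  "outerplanar G \<longleftrightarrow>
     (\<forall>H. subgraph H G \<and> finite (verts H) \<longrightarrow> (\<exists>p \<gamma>. outerplanar_embedding H p \<gamma>))"

lemma outerplanar_embedding_subgraph:
  assumes "outerplanar_embedding G p \<gamma>" "subgraph H G"
  shows "outerplanar_embedding H p \<gamma>"
proof -
  have V: "verts H \<subseteq> verts G" and wf: "wf_digraph H"
    using assms(2) by (auto simp: subgraph_def)
  have E: "e \<in> edges G" if "e \<in> edges H" for e
  proof -
    have "arcs_ends H \<subseteq> arcs_ends G"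
      using assms(2) by (auto simp: subgraph_def compatible_def arcs_ends_conv)
    then show ?thesis using that by (auto simp: edges_def)
  qed
  have ends: "e \<subseteq> verts H" if "e \<in> edges H" for e
    using that wf_digraph.adj_in_verts[OF wf] by (auto simp: edges_def)
  have G: "planar_embedding G p \<gamma>" "p ` verts G \<subseteq> sphere 0 1"
    "\<And>e. e \<in> edges G \<Longrightarrow> path_image (\<gamma> e) \<subseteq> cball 0 1"
    using assms(1) by (simp_all add: outerplanar_embedding_def)
  have meet: "path_image (\<gamma> e) \<inter> p ` verts H = p ` e" if "e \<in> edges H" for e
  proof -
    have "path_image (\<gamma> e) \<inter> p ` verts G = p ` e"
      using G(1) E[OF that] by (simp add: planar_embedding_def)
    then show ?thesis using V ends[OF that] by blast
  qed
  have "planar_embedding H p \<gamma>"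
    unfolding planar_embedding_def
  proof (intro conjI ballI impI)
    show "inj_on p (verts H)"
      by (rule inj_on_subset[OF _ V]) (use G(1) in \<open>simp add: planar_embedding_def\<close>)
  next
    fix e assume e: "e \<in> edges H"
    show "Path_Connected.arc (\<gamma> e)" "{pathstart (\<gamma> e), pathfinish (\<gamma> e)} = p ` e"
      using G(1) E[OF e] by (simp_all add: planar_embedding_def)
    show "path_image (\<gamma> e) \<inter> p ` verts H = p ` e"
      using meet[OF e] .
  next
    fix e f assume "e \<in> edges H" "f \<in> edges H" "e \<noteq> f"
    then show "path_image (\<gamma> e) \<inter> path_image (\<gamma> f) = p ` (e \<inter> f)"
      using G(1) E by (simp add: planar_embedding_def)
  qed
  moreover have "p ` verts H \<subseteq> sphere 0 1"
    using order_trans[OF image_mono[OF V] G(2)] .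
  ultimately show ?thesis
    unfolding outerplanar_embedding_def using G(3)[OF E] by simp
qed

lemma outerplanar_iff_embedding:
  assumes "wf_digraph G" "finite (verts G)"
  shows "outerplanar G \<longleftrightarrow> (\<exists>p \<gamma>. outerplanar_embedding G p \<gamma>)"
proof -
  have "subgraph G G" using assms(1) by (simp add: subgraph_def compatible_def)
  then have "\<exists>p \<gamma>. outerplanar_embedding G p \<gamma>" if "outerplanar G"
    using assms(2) that unfolding outerplanar_def by simp
  moreover have "outerplanar G" if "outerplanar_embedding G p \<gamma>" for p \<gamma>
    using outerplanar_embedding_subgraph[OF that] unfolding outerplanar_def by meson
  ultimately show ?thesis by metis
qed


section \<open>Ring graphs\<close>

text \<open>
  A cycle is identified with its set of edges, so that closed walks differing only in starting point
  or direction give the same cycle; its vertices are the elements of \<open>\<Union>C\<close>. The bound on the length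
  excludes the cycles \<open>u, v, u\<close> of a symmetric digraph.
\<close>

definition cycles :: "('a, 'b) pre_digraph \<Rightarrow> 'a set set set" where
  "cycles G =
     {(\<lambda>a. {tail G a, head G a}) ` set c | c. pre_digraph.cycle G c \<and> 3 \<le> length c}"

definition is_chord :: "('a, 'b) pre_digraph \<Rightarrow> 'a set \<Rightarrow> 'a set set \<Rightarrow> bool" where
  "is_chord G e C \<longleftrightarrow> e \<in> edges G \<and> e \<subseteq> \<Union>C \<and> e \<notin> C"

definition primitive_cycles :: "('a, 'b) pre_digraph \<Rightarrow> 'a set set set" where
  "primitive_cycles G = {C \<in> cycles G. \<nexists>e. is_chord G e C}"

definition primitive_cycle_property :: "('a, 'b) pre_digraph \<Rightarrow> bool" where
  "primitive_cycle_property G \<longleftrightarrow>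
     (\<forall>C \<in> primitive_cycles G. \<forall>D \<in> primitive_cycles G. C \<noteq> D \<longrightarrow> card (C \<inter> D) \<le> 1)"

definition contains_K4_subdivision :: "('a, 'b) pre_digraph \<Rightarrow> bool" where
  "contains_K4_subdivision G \<longleftrightarrow>
     (\<exists>H. subgraph H G \<and>
       (\<exists>K rev_K rev_H. subdivision (K, rev_K) (H, rev_H) \<and> K\<^bsub>4\<^esub> K))"

text \<open>
  Of the two equivalent definitions of a ring graph we take the one that does not involve the cycle
  rank \<open>e - v + c\<close>, which makes sense only for finite graphs.
\<close>

definition ring_graph :: "('a, 'b) pre_digraph \<Rightarrow> bool" where
  "ring_graph G \<longleftrightarrow> primitive_cycle_property G \<and> \<not> contains_K4_subdivision G"

end

theory Submission
  imports Defs "HOL-Analysis.Fashoda_Theorem"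
begin

text \<open>
  Both equivalences follow from a dichotomy: each of the two graphs either contains four pairwise
  adjacent vertices, and is then neither outerplanar nor a ring graph, or it is a disjoint union of
  windmills (triangles and edges glued together at one vertex, the hub), and is then both.

  An element \<open>x\<close> of order at least 4 or of infinite order gives the clique formed by \<open>inv x\<close>, \<open>1\<close>, \<open>x\<close>
  and \<open>x\<^sup>2\<close> in the power graph; otherwise all elements have order at most 3 and the power graph is a
  windmill around the identity. In the proper power graph the clique is formed by \<open>inv (x\<^sup>2)\<close>,
  \<open>inv x\<close>, \<open>x\<close> and \<open>x\<^sup>2\<close> for \<open>x\<close> of order at least 5 or of infinite order; otherwise all orders are at
  most 4 and the windmills are formed by the elements of order 4 around the involution that is their
  square (\<open>windmill_power_graph\<close>, \<open>windmill_proper_power_graph\<close>).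

  A clique on four vertices is its own subdivision. It has no outerplanar embedding, since among four
  points on a circle there are two pairs with crossing chords, and arcs in the disc that join the points
  of each pair must meet by the Fashoda meet theorem (\<open>arcs_with_crossing_chords_meet\<close>).

  Conversely, let a graph be a union of windmills. Ordering the vertices around the circle so that each
  blade follows its hub lets all edges be drawn as chords without crossings (\<open>noncrossing_order\<close>,
  \<open>outerplanar_embedding_of_noncrossing_order\<close>). Each cycle is one of the triangles, and these share no
  edges (\<open>cycle_is_triangle\<close>). Only hubs can have degree at least 3, and no two hubs are connected, so
  there is no subdivision of the complete graph on 4 vertices (\<open>no_K4_subdivision\<close>).
\<close>


section \<open>Arcs in a disc with crossing chords\<close>

text \<open>
  On the line through two points of the unit circle the squared norm is a quadratic polynomial in the
  affine parameter with value 1 at both points, so the line leaves the disc beyond the chord.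
\<close>

lemma norm_sphere_chord_line:
  fixes a c :: complex
  assumes "norm a = 1" "norm c = 1"
  shows "(norm (a + of_real \<mu> * (a - c)))\<^sup>2 = 1 + (\<mu> + \<mu>\<^sup>2) * (norm (a - c))\<^sup>2"
proof -
  have "(Re a)\<^sup>2 + (Im a)\<^sup>2 = 1" "(Re c)\<^sup>2 + (Im c)\<^sup>2 = 1"
    using assms by (simp_all add: cmod_def)
  then show ?thesis
    unfolding cmod_power2 by (simp add: power2_eq_square) algebra
qed

lemma chord_extension_leaves_disc:
  fixes a c :: complex
  assumes "norm a = 1" "norm c = 1" "a \<noteq> c" "0 \<le> M"
    and "z \<in> closed_segment (a + of_real M * (a - c)) a" "norm z \<le> 1"
  shows "z = a"
proof -
  obtain u where u: "0 \<le> u" "u \<le> 1"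
    and z: "z = (1 - u) *\<^sub>R (a + of_real M * (a - c)) + u *\<^sub>R a"
    using assms(5) by (auto simp: in_segment)
  define \<mu> where "\<mu> = (1 - u) * M"
  have z': "z = a + of_real \<mu> * (a - c)"
    unfolding z \<mu>_def scaleR_conv_of_real by (simp add: algebra_simps)
  have "0 \<le> \<mu>" using u assms(4) by (simp add: \<mu>_def)
  have "(norm z)\<^sup>2 \<le> 1" using assms(6) by (simp add: power_le_one)
  then have "(\<mu> + \<mu>\<^sup>2) * (norm (a - c))\<^sup>2 \<le> 0"
    using norm_sphere_chord_line[OF assms(1,2), of \<mu>] z' by simp
  moreover have "0 < (norm (a - c))\<^sup>2" using assms(3) by simp
  ultimately have "\<mu> + \<mu>\<^sup>2 \<le> 0" by (simp add: mult_le_0_iff)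
  then have "\<mu> = 0" using \<open>0 \<le> \<mu>\<close>
    by (smt (verit) zero_le_power2)
  then show ?thesis using z' by simp
qed

lemma sphere_closed_segment_endpoints:
  fixes a c z :: complex
  assumes "norm a = 1" "norm c = 1" "norm z = 1" "z \<in> closed_segment a c"
  shows "z = a \<or> z = c"
proof (cases "a = c")
  case False
  obtain u where u: "z = (1 - u) *\<^sub>R a + u *\<^sub>R c"
    using assms(4) by (auto simp: in_segment)
  have z': "z = a + of_real (- u) * (a - c)"
    unfolding u scaleR_conv_of_real by (simp add: algebra_simps)
  have "(- u + (- u)\<^sup>2) * (norm (a - c))\<^sup>2 = 0"
    using norm_sphere_chord_line[OF assms(1,2), of "- u"] z' assms(3) by simp
  then have "u = 0 \<or> u = 1" using False by (auto simp: power2_eq_square)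
  then show ?thesis using u by auto
qed (use assms in auto)

text \<open>
  The Fashoda meet theorem is about paths that join opposite sides of a rectangle. To reach this
  situation, the crossing chords are taken as coordinate axes, and each path is extended at both ends
  along the line of its chord until it leaves a large rectangle around the disc. The extensions lie
  outside the disc and on different axes, so they create no new intersection.
\<close>

lemma arcs_with_crossing_chords_meet:
  fixes f g :: "real \<Rightarrow> complex"
  assumes f: "path f" "path_image f \<subseteq> cball 0 1" "pathstart f = a" "pathfinish f = c"
    and g: "path g" "path_image g \<subseteq> cball 0 1" "pathstart g = b" "pathfinish g = d"
    and sphere: "norm a = 1" "norm b = 1" "norm c = 1" "norm d = 1"
    and dist: "distinct [a, b, c, d]"
    and cross: "closed_segment a c \<inter> closed_segment b d \<noteq> {}"
  shows "path_image f \<inter> path_image g \<noteq> {}"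
proof -
  obtain w where w: "w \<in> closed_segment a c" "w \<in> closed_segment b d" using cross by blast
  obtain u where u: "0 \<le> u" "u \<le> 1" "w = (1 - u) *\<^sub>R a + u *\<^sub>R c"
    using w(1) by (auto simp: in_segment)
  obtain v where v: "0 \<le> v" "v \<le> 1" "w = (1 - v) *\<^sub>R b + v *\<^sub>R d"
    using w(2) by (auto simp: in_segment)
  have w1: "w \<notin> {b, d}" "w \<notin> {a, c}"
  proof -
    show "w \<notin> {b, d}"
    proof
      assume "w \<in> {b, d}"
      moreover from this have "w = a \<or> w = c"
        using sphere_closed_segment_endpoints[OF sphere(1,3) _ w(1)] sphere by blast
      ultimately show False using dist by auto
    qed
    show "w \<notin> {a, c}"
    proof
      assume "w \<in> {a, c}"
      moreover from this have "w = b \<or> w = d"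
        using sphere_closed_segment_endpoints[OF sphere(2,4) _ w(2)] sphere by blast
      ultimately show False using dist by auto
    qed
  qed
  have "closed_segment a c \<subseteq> cball 0 1"
    using sphere by (intro closed_segment_subset) auto
  then have nw: "norm w \<le> 1" using w(1) by auto
  \<comment> \<open>the coordinates \<open>s\<close> and \<open>t\<close> of a point with respect to the origin \<open>w\<close> and the basis
     \<open>c - a\<close>, \<open>d - b\<close>, by Cramer's rule; \<open>cr\<close> is the cross product\<close>
  define cr where "cr x y = Re x * Im y - Im x * Re y" for x y
  define D where "D = cr (c - a) (d - b)"
  have "D \<noteq> 0"
  proof
    assume "D = 0"
    have "c - a \<noteq> 0" using dist by auto
    obtain k where k: "d - b = of_real k * (c - a)"
    proof (cases "Re (c - a) = 0")
      case True
      then have "Im (c - a) \<noteq> 0" using \<open>c - a \<noteq> 0\<close> by (auto simp: complex_eq_iff)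
      then have "d - b = of_real (Im (d - b) / Im (c - a)) * (c - a)"
        using True \<open>D = 0\<close> by (auto simp: D_def cr_def complex_eq_iff)
      then show ?thesis using that by blast
    next
      case False
      then have "d - b = of_real (Re (d - b) / Re (c - a)) * (c - a)"
        using \<open>D = 0\<close> by (auto simp: D_def cr_def complex_eq_iff field_simps)
      then show ?thesis using that by blast
    qed
    have "b = w - of_real v * (d - b)" using v(3) by (simp add: scaleR_conv_of_real algebra_simps)
    also have "\<dots> = a + of_real u * (c - a) - of_real v * (of_real k * (c - a))"
      unfolding k using u(3) by (simp add: scaleR_conv_of_real algebra_simps)
    also have "\<dots> = a + of_real (v * k - u) * (a - c)" by (simp add: algebra_simps)
    finally have b: "b = a + of_real (v * k - u) * (a - c)" .
    define m where "m = v * k - u"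
    have "(m + m\<^sup>2) * (norm (a - c))\<^sup>2 = 0"
      using norm_sphere_chord_line[OF sphere(1,3), of m] b sphere(2) by (simp add: m_def)
    then have "m + m\<^sup>2 = 0" using dist by auto
    then have "m * (1 + m) = 0" by (simp add: power2_eq_square algebra_simps)
    then have "m = 0 \<or> m = -1" by (auto simp: add_eq_0_iff)
    then have "b = a \<or> b = c" using b unfolding m_def[symmetric] by auto
    then show False using dist by auto
  qed
  define s where "s z = cr (z - w) (d - b) / D" for z
  define t where "t z = cr (c - a) (z - w) / D" for z
  define h :: "complex \<Rightarrow> real^2" where "h z = vector [s z, t z]" for z
  have h1: "h z $ 1 = s z" and h2: "h z $ 2 = t z" for z by (simp_all add: h_def)
  have inj: "z = z'" if "h z = h z'" for z z'
  proof -
    have "s z = s z'" "t z = t z'" using that h1 h2 by metis+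
    then have "cr (z - w) (d - b) = cr (z' - w) (d - b)" "cr (c - a) (z - w) = cr (c - a) (z' - w)"
      using \<open>D \<noteq> 0\<close> by (auto simp: s_def t_def)
    then have "Re (z - z') * Im (d - b) = Im (z - z') * Re (d - b)"
      "Re (z - z') * Im (c - a) = Im (z - z') * Re (c - a)"
      by (auto simp: cr_def algebra_simps)
    then have "Re (z - z') * D = 0" "Im (z - z') * D = 0"
      unfolding D_def cr_def by algebra+
    then show ?thesis using \<open>D \<noteq> 0\<close> by (auto simp: complex_eq_iff)
  qed
  have "cr (p - w) y - cr (q - w) y = cr (p - q) y" "cr y (p - w) - cr y (q - w) = cr y (p - q)"
    for p q y
    by (simp_all add: cr_def algebra_simps)
  then have "s p - s q = cr (p - q) (d - b) / D" "t p - t q = cr (c - a) (p - q) / D" for p q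
    by (simp_all add: s_def t_def flip: diff_divide_distrib)
  then have ca: "s c - s a = 1" and db: "t d - t b = 1"
    using \<open>D \<noteq> 0\<close> by (simp_all add: D_def)
  have axis_t: "t a = 0" "t c = 0"
    unfolding t_def u(3) cr_def by (auto simp: algebra_simps)
  have axis_s: "s b = 0" "s d = 0"
    unfolding s_def v(3) cr_def by (auto simp: algebra_simps)
  have s_lin: "s (p + of_real r * (q - q')) = s p + r * (s q - s q')" for p q q' r
    by (simp add: s_def cr_def divide_simps) (simp add: algebra_simps)
  have t_lin: "t (p + of_real r * (q - q')) = t p + r * (t q - t q')" for p q q' r
    by (simp add: t_def cr_def divide_simps) (simp add: algebra_simps)
  have cont: "continuous_on A h" for A
  proof -
    have "continuous_on A s" "continuous_on A t"
      unfolding s_def t_def cr_def by (auto intro!: continuous_intros simp: \<open>D \<noteq> 0\<close>)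
    then have "continuous_on A (\<lambda>z. if i = 1 then s z else t z)" for i :: 2
      by (cases "i = 1") simp_all
    then have "continuous_on A (\<lambda>z. (\<chi> i::2. if i = 1 then s z else t z))"
      by (rule continuous_on_vec_lambda)
    moreover have "h = (\<lambda>z. (\<chi> i::2. if i = 1 then s z else t z))"
      by (auto simp: fun_eq_iff vec_eq_iff forall_2 h1 h2)
    ultimately show ?thesis by simp
  qed
  obtain B where B: "\<And>z. norm z \<le> 1 \<Longrightarrow> \<bar>s z\<bar> \<le> B" "\<And>z. norm z \<le> 1 \<Longrightarrow> \<bar>t z\<bar> \<le> B" "0 \<le> B"
  proof -
    have "compact (h ` cball 0 1)" using cont by (intro compact_continuous_image) auto
    then obtain B where "\<And>x. x \<in> h ` cball 0 1 \<Longrightarrow> norm x \<le> B"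
      by (meson compact_imp_bounded bounded_iff)
    then have "norm (h z) \<le> B" if "norm z \<le> 1" for z using that by auto
    then have "\<bar>s z\<bar> \<le> B \<and> \<bar>t z\<bar> \<le> B \<and> 0 \<le> B" if "norm z \<le> 1" for z
      using component_le_norm_cart[of "h z"] h1 h2 that by (smt (verit) norm_ge_zero)
    then show ?thesis using that by (metis norm_zero zero_le_one)
  qed
  \<comment> \<open>\<open>s\<close> grows by 1 from \<open>a\<close> to \<open>c\<close>, so extending the chord \<open>M\<close> times beyond \<open>a\<close> gives \<open>s a - M \<le> - B\<close>\<close>
  define M where "M = 2 * B"
  have M: "0 \<le> M" "B \<le> M - B" using B(3) by (auto simp: M_def)
  define a' c' b' d' where "a' = a + of_real M * (a - c)" and "c' = c + of_real M * (c - a)"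
    and "b' = b + of_real M * (b - d)" and "d' = d + of_real M * (d - b)"
  define F where "F = linepath a' a +++ f +++ linepath c c'"
  define H where "H = linepath b' b +++ g +++ linepath d d'"
  have F: "path F" "pathstart F = a'" "pathfinish F = c'"
    "path_image F = closed_segment a' a \<union> (path_image f \<union> closed_segment c' c)"
    using f by (auto simp: F_def path_image_join closed_segment_commute)
  have H: "path H" "pathstart H = b'" "pathfinish H = d'"
    "path_image H = closed_segment b' b \<union> (path_image g \<union> closed_segment d' d)"
    using g by (auto simp: H_def path_image_join closed_segment_commute)
  have "s c = s a + 1" "t d = t b + 1" using ca db by linarith+
  then have sa': "s a' = s a - M" "s c' = s c + M" "t a' = 0" "t c' = 0"
    and tb': "t b' = t b - M" "t d' = t d + M" "s b' = 0" "s d' = 0"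
    using axis_s axis_t by (simp_all add: a'_def b'_def c'_def d'_def s_lin t_lin)
  have s_seg: "s z \<in> closed_segment (s p) (s q)" "t z \<in> closed_segment (t p) (t q)"
    if zpq: "z \<in> closed_segment p q" for z p q
  proof -
    obtain r where r: "0 \<le> r" "r \<le> 1" "z = (1 - r) *\<^sub>R p + r *\<^sub>R q"
      using zpq by (auto simp: in_segment)
    have z: "z = p + of_real r * (q - p)"
      unfolding r(3) scaleR_conv_of_real by (simp add: algebra_simps)
    show "s z \<in> closed_segment (s p) (s q)" "t z \<in> closed_segment (t p) (t q)"
      unfolding z s_lin t_lin in_segment using r by (auto intro!: exI[of _ r] simp: algebra_simps)
  qed
  have Bs: "\<bar>s a\<bar> \<le> B" "\<bar>s c\<bar> \<le> B" "\<bar>t b\<bar> \<le> B" "\<bar>t d\<bar> \<le> B"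
    using B sphere by auto
  define lo :: "real^2" where "lo = vector [s a - M, t b - M]"
  define hi :: "real^2" where "hi = vector [s c + M, t d + M]"
  have in_box: "h z \<in> cbox lo hi \<longleftrightarrow>
      s a - M \<le> s z \<and> s z \<le> s c + M \<and> t b - M \<le> t z \<and> t z \<le> t d + M" for z
    by (auto simp: mem_box_cart forall_2 lo_def hi_def h1 h2)
  have disc: "h z \<in> cbox lo hi" if "z \<in> cball 0 1" for z
    unfolding in_box using B(1,2)[of z] Bs M that by auto
  have box_seg: "h z \<in> cbox lo hi"
    if "h p \<in> cbox lo hi" "h q \<in> cbox lo hi" "z \<in> closed_segment p q" for z p q
  proof -
    have seg: "x \<in> {l..k}"
      if "x \<in> closed_segment y y'" "y \<in> {l..k}" "y' \<in> {l..k}" for x y y' l k :: real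
      using that closed_segment_subset[of y "{l..k}" y'] by (meson convex_real_interval(5) subsetD)
    show ?thesis
      using seg[OF s_seg(1)[OF that(3)], of "s a - M" "s c + M"]
        seg[OF s_seg(2)[OF that(3)], of "t b - M" "t d + M"] that(1,2) unfolding in_box by auto
  qed
  have "h a' \<in> cbox lo hi" "h b' \<in> cbox lo hi" "h c' \<in> cbox lo hi" "h d' \<in> cbox lo hi"
    using sa' tb' Bs M unfolding in_box by auto
  moreover have "h a \<in> cbox lo hi" "h b \<in> cbox lo hi" "h c \<in> cbox lo hi" "h d \<in> cbox lo hi"
    using disc sphere by auto
  ultimately have segs: "h z \<in> cbox lo hi"
    if "z \<in> closed_segment a' a \<union> closed_segment c' c \<union>
      closed_segment b' b \<union> closed_segment d' d" for z
    using box_seg that by blast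
  have Fbox: "path_image (h \<circ> F) \<subseteq> cbox lo hi" and Hbox: "path_image (h \<circ> H) \<subseteq> cbox lo hi"
    using disc segs f(2) g(2) unfolding path_image_compose F H by auto
  obtain x where "x \<in> path_image (h \<circ> F)" "x \<in> path_image (h \<circ> H)"
  proof (rule fashoda[OF _ _ Fbox Hbox])
    show "path (h \<circ> F)" "path (h \<circ> H)"
      using F(1) H(1) cont by (auto intro: path_continuous_image)
  qed (simp_all add: pathstart_compose pathfinish_compose F H h1 h2 sa' tb' lo_def hi_def)
  then obtain z where zF: "z \<in> path_image F" and zH: "z \<in> path_image H"
    using inj unfolding path_image_compose by blast
  have extF: "z = a \<or> z = c" if "norm z \<le> 1" "z \<in> closed_segment a' a \<union> closed_segment c' c" for z
    using that chord_extension_leaves_disc[OF sphere(1,3) _ M(1)]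
      chord_extension_leaves_disc[OF sphere(3,1) _ M(1)] dist by (auto simp: a'_def c'_def)
  have extH: "z = b \<or> z = d" if "norm z \<le> 1" "z \<in> closed_segment b' b \<union> closed_segment d' d" for z
    using that chord_extension_leaves_disc[OF sphere(2,4) _ M(1)]
      chord_extension_leaves_disc[OF sphere(4,2) _ M(1)] dist by (auto simp: b'_def d'_def)
  have ends: "a \<in> path_image f" "c \<in> path_image f" "b \<in> path_image g" "d \<in> path_image g"
    using f g by (auto simp: pathstart_in_path_image pathfinish_in_path_image)
  \<comment> \<open>a common point of two extensions would be the origin \<open>w\<close>, which lies inside the disc\<close>
  have "\<not> (z \<in> closed_segment a' a \<union> closed_segment c' c \<and>
      z \<in> closed_segment b' b \<union> closed_segment d' d)"
  proof
    assume z: "z \<in> closed_segment a' a \<union> closed_segment c' c \<and>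
      z \<in> closed_segment b' b \<union> closed_segment d' d"
    then have "t z = 0" using s_seg(2)[of z a' a] s_seg(2)[of z c' c] sa' axis_t by auto
    moreover have "s z = 0" using z s_seg(1)[of z b' b] s_seg(1)[of z d' d] tb' axis_s by auto
    moreover have "s w = 0" "t w = 0" by (simp_all add: s_def t_def cr_def)
    ultimately have "h z = h w" by (simp add: h_def)
    then have "z = w" by (rule inj)
    then show False using extF[of z] z nw w1 by auto
  qed
  moreover have "z \<in> path_image f \<or> z \<in> closed_segment a' a \<union> closed_segment c' c"
    "z \<in> path_image g \<or> z \<in> closed_segment b' b \<union> closed_segment d' d"
    using zF zH unfolding F(4) H(4) by blast+
  moreover have "norm z \<le> 1" if "z \<in> path_image f \<or> z \<in> path_image g"
    using that f(2) g(2) by auto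
  ultimately have "z \<in> path_image f \<and> z \<in> path_image g"
    using extF[of z] extH[of z] ends by metis
  then show ?thesis by blast
qed

text \<open>
  By Radon's theorem the four points split into two sets whose convex hulls meet. Neither of them is a
  singleton, as a point of the circle is not in the convex hull of other points of the circle.
\<close>

lemma four_points_on_circle_cross:
  fixes Q :: "complex set"
  assumes "card Q = 4" "Q \<subseteq> sphere 0 1"
  obtains a b c d where "distinct [a, b, c, d]" "{a, b, c, d} = Q"
    "closed_segment a c \<inter> closed_segment b d \<noteq> {}"
proof -
  have fin: "finite Q" using assms(1) by (metis card.infinite zero_neq_numeral)
  have "affine_dependent Q"
    using fin assms(1) by (intro affine_dependent_biggerset) auto
  then obtain M P where MP: "M \<subseteq> Q" "P \<subseteq> Q" "M \<inter> P = {}" "convex hull M \<inter> convex hull P \<noteq> {}"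
    by (rule Radon)
  have two: "2 \<le> card M"
    if MP: "M \<subseteq> Q" "P \<subseteq> Q" "M \<inter> P = {}" "convex hull M \<inter> convex hull P \<noteq> {}" for M P
  proof (rule ccontr)
    assume "\<not> 2 \<le> card M"
    moreover have "finite M" using MP(1) fin finite_subset by blast
    moreover have "M \<noteq> {}" using MP(4) by auto
    ultimately have "card M = 1"
      by (metis One_nat_def Suc_leI card_gt_0_iff le_antisym not_less_eq_eq numeral_2_eq_2)
    then obtain x where x: "M = {x}" by (auto simp: card_1_singleton_iff)
    \<comment> \<open>the tangent at \<open>x\<close> separates \<open>x\<close> from the rest of the circle\<close>
    have "P \<subseteq> {y. x \<bullet> y < 1}"
    proof
      fix y assume "y \<in> P"
      then have y: "norm y = 1" "y \<noteq> x" using MP x assms(2) by auto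
      have nx: "norm x = 1" using MP(1) x assms(2) by auto
      have "0 < (norm (x - y))\<^sup>2" using y by simp
      then have "x \<bullet> y < 1" using nx y(1)
        by (simp add: power2_norm_eq_inner inner_diff_left inner_diff_right inner_commute norm_eq_1)
      then show "y \<in> {y. x \<bullet> y < 1}" by simp
    qed
    then have "convex hull P \<subseteq> {y. x \<bullet> y < 1}"
      by (intro hull_minimal convex_halfspace_lt)
    moreover have "x \<in> convex hull P" using MP(4) x by auto
    moreover have "x \<bullet> x = 1" using MP(1) x assms(2) by (auto simp: norm_eq_1)
    ultimately show False by auto
  qed
  have "card M + card P \<le> 4"
    using MP fin assms(1) by (metis card_Un_disjoint card_mono finite_subset le_sup_iff)
  moreover have "2 \<le> card M" "2 \<le> card P"
    using two[OF MP] two[of P M] MP by (auto simp: Int_commute)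
  ultimately have "card M = 2" "card P = 2" by auto
  then obtain a c b d where ac: "M = {a, c}" "a \<noteq> c" and bd: "P = {b, d}" "b \<noteq> d"
    by (auto simp: card_2_iff)
  have "distinct [a, b, c, d]" using ac bd MP(3) by auto
  moreover have "{a, b, c, d} = Q"
    using MP(1,2) ac bd calculation by (intro card_subset_eq) (auto simp: fin assms(1))
  moreover have "closed_segment a c \<inter> closed_segment b d \<noteq> {}"
    using MP(4) ac bd by (simp add: segment_convex_hull)
  ultimately show ?thesis by (rule that)
qed


section \<open>Chords of a circle and outerplanar drawings\<close>

text \<open>
  The rational parametrization of the unit circle without the point \<open>-1\<close>. It traverses the circle
  monotonically, so the cyclic order of points on the circle is the order of their parameters.
\<close>

definition circle_point :: "real \<Rightarrow> complex" where
  "circle_point t = Complex ((1 - t\<^sup>2) / (1 + t\<^sup>2)) (2 * t / (1 + t\<^sup>2))"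

text \<open>
  The affine function that vanishes on the line through the points with parameters \<open>s\<close> and \<open>t\<close>;
  its sign tells the two sides of this line apart. For \<open>s = t\<close> the line is the tangent.
\<close>

definition chord_side :: "real \<Rightarrow> real \<Rightarrow> complex \<Rightarrow> real" where
  "chord_side s t z = Re z * (1 - s * t) + Im z * (s + t) - (1 + s * t)"

lemma one_plus_square_pos: "0 < 1 + t\<^sup>2" for t :: real
  by (simp add: add_pos_nonneg)

lemma chord_side_circle_point:
  "chord_side s t (circle_point u) = - 2 * ((u - s) * (u - t)) / (1 + u\<^sup>2)"
proof -
  have "chord_side s t (circle_point u) * (1 + u\<^sup>2)
      = (1 - u\<^sup>2) * (1 - s * t) + 2 * u * (s + t) - (1 + s * t) * (1 + u\<^sup>2)"
  proof -
    have "Re (circle_point u) * (1 + u\<^sup>2) = 1 - u\<^sup>2" "Im (circle_point u) * (1 + u\<^sup>2) = 2 * u"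
      using one_plus_square_pos[of u] by (simp_all add: circle_point_def)
    then show ?thesis unfolding chord_side_def by algebra
  qed
  also have "\<dots> = - 2 * ((u - s) * (u - t))" by (simp add: algebra_simps power2_eq_square)
  finally show ?thesis
    using nonzero_eq_divide_eq[of "1 + u\<^sup>2"] one_plus_square_pos[of u] by (metis less_irrefl)
qed

lemma chord_side_eq_0_iff: "chord_side s t (circle_point u) = 0 \<longleftrightarrow> u = s \<or> u = t"
  using one_plus_square_pos[of u] by (auto simp: chord_side_circle_point)

lemma inj_circle_point: "inj circle_point"
proof (rule injI)
  fix s t assume "circle_point s = circle_point t"
  then show "s = t" using chord_side_eq_0_iff[of t t s] chord_side_eq_0_iff[of t t t] by simp
qed

lemma norm_circle_point: "norm (circle_point t) = 1"
proof -
  have "(1 - t\<^sup>2)\<^sup>2 + (2 * t)\<^sup>2 = (1 + t\<^sup>2)\<^sup>2" by (simp add: power2_eq_square algebra_simps)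
  then have "((1 - t\<^sup>2) / (1 + t\<^sup>2))\<^sup>2 + (2 * t / (1 + t\<^sup>2))\<^sup>2 = 1"
    using one_plus_square_pos[of t] by (simp add: power_divide flip: add_divide_distrib)
  then show ?thesis by (simp add: circle_point_def cmod_def)
qed

lemma chord_side_convex:
  "chord_side s t ((1 - r) *\<^sub>R y + r *\<^sub>R z) = (1 - r) * chord_side s t y + r * chord_side s t z"
  by (simp add: chord_side_def algebra_simps)

text \<open>
  The hypothesis on the product says that \<open>u\<close> and \<open>v\<close> do not interlace with \<open>s\<close> and \<open>t\<close>, that is,
  the endpoints of one chord lie weakly on one side of the other.
\<close>

lemma noncrossing_chords_meet_in_endpoints:
  assumes "u \<noteq> v" "{s, t} \<noteq> {u, v}"
    and "0 \<le> ((u - s) * (u - t)) * ((v - s) * (v - t))"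
  shows "closed_segment (circle_point s) (circle_point t) \<inter>
      closed_segment (circle_point u) (circle_point v) = circle_point ` ({s, t} \<inter> {u, v})"
proof
  let ?p = circle_point
  show "closed_segment (?p s) (?p t) \<inter> closed_segment (?p u) (?p v) \<subseteq> ?p ` ({s, t} \<inter> {u, v})"
  proof
    fix z assume z: "z \<in> closed_segment (?p s) (?p t) \<inter> closed_segment (?p u) (?p v)"
    obtain q where "z = (1 - q) *\<^sub>R ?p s + q *\<^sub>R ?p t" using z by (auto simp: in_segment)
    then have "chord_side s t z = 0"
      using chord_side_eq_0_iff[of s t s] chord_side_eq_0_iff[of s t t]
      by (simp add: chord_side_convex)
    moreover obtain r where r: "0 \<le> r" "r \<le> 1" "z = (1 - r) *\<^sub>R ?p u + r *\<^sub>R ?p v"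
      using z by (auto simp: in_segment)
    ultimately have sum0: "(1 - r) * chord_side s t (?p u) + r * chord_side s t (?p v) = 0"
      by (simp add: chord_side_convex)
    define A B where "A = chord_side s t (?p u)" and "B = chord_side s t (?p v)"
    have "A * B = 4 / ((1 + u\<^sup>2) * (1 + v\<^sup>2)) * (((u - s) * (u - t)) * ((v - s) * (v - t)))"
      by (simp add: A_def B_def chord_side_circle_point)
    then have "0 \<le> A * B"
      using assms(3) one_plus_square_pos[of u] one_plus_square_pos[of v] by simp
    moreover have AB: "(1 - r) * A + r * B = 0" using sum0 by (simp add: A_def B_def)
    ultimately have A0: "(1 - r) * A = 0"
    proof -
      have "((1 - r) * A)\<^sup>2 = - ((1 - r) * r * (A * B))"
        using AB by (simp add: power2_eq_square) algebra
      also have "\<dots> \<le> 0" using r \<open>0 \<le> A * B\<close> by simp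
      finally show ?thesis by simp
    qed
    then have B0: "r * B = 0" using AB by linarith
    have uv: "A = 0 \<Longrightarrow> u \<in> {s, t}" "B = 0 \<Longrightarrow> v \<in> {s, t}"
      by (auto simp: A_def B_def chord_side_eq_0_iff)
    show "z \<in> ?p ` ({s, t} \<inter> {u, v})"
    proof (cases "r = 0 \<or> r = 1")
      case True
      then have "z = ?p u \<and> A = 0 \<or> z = ?p v \<and> B = 0"
        using r(3) A0 B0 by auto
      then show ?thesis using uv by blast
    next
      case False
      then have "u \<in> {s, t}" "v \<in> {s, t}" using A0 B0 uv by auto
      then show ?thesis using assms(1,2) by auto
    qed
  qed
qed auto

lemma ends_of_edge:
  assumes "e \<in> edges H"
  obtains u v where "e = {u, v}" "u \<rightarrow>\<^bsub>H\<^esub> v"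
  using assms by (auto simp: edges_def)

text \<open>
  Vertices are placed on the circle in the order given by \<open>f\<close>, and edges are drawn as chords.
\<close>

lemma outerplanar_embedding_of_noncrossing_order:
  fixes f :: "'a \<Rightarrow> real"
  assumes wf: "wf_digraph H" and loopfree: "\<And>u. \<not> u \<rightarrow>\<^bsub>H\<^esub> u"
    and inj: "inj_on f (verts H)"
    and noncross: "\<And>a b c d. a \<rightarrow>\<^bsub>H\<^esub> b \<Longrightarrow> c \<rightarrow>\<^bsub>H\<^esub> d \<Longrightarrow>
      0 \<le> ((f c - f a) * (f c - f b)) * ((f d - f a) * (f d - f b))"
  shows "\<exists>p \<gamma>. outerplanar_embedding H p \<gamma>"
proof -
  define p where "p = circle_point \<circ> f"
  \<comment> \<open>\<open>Min\<close> and \<open>Max\<close> pick the two ends of an edge, which is an unordered pair\<close>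
  define \<gamma> where "\<gamma> e = linepath (circle_point (Min (f ` e))) (circle_point (Max (f ` e)))" for e
  have ends: "u \<in> verts H" "v \<in> verts H" "u \<noteq> v" "f u \<noteq> f v" if "u \<rightarrow>\<^bsub>H\<^esub> v" for u v
    using that wf_digraph.adj_in_verts[OF wf that] loopfree inj by (auto dest: inj_onD)
  have image: "path_image (\<gamma> {u, v}) = closed_segment (p u) (p v)"
    and pends: "{pathstart (\<gamma> {u, v}), pathfinish (\<gamma> {u, v})} = {p u, p v}" for u v
    by (auto simp: \<gamma>_def p_def min_def max_def closed_segment_commute)
  have injp: "inj_on p (verts H)"
    unfolding p_def using inj inj_circle_point
    by (auto intro!: comp_inj_on inj_on_subset[of circle_point UNIV])
  have "planar_embedding H p \<gamma>"
    unfolding planar_embedding_def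
  proof (intro conjI ballI impI injp)
    fix e assume "e \<in> edges H"
    then obtain u v where e: "e = {u, v}" "u \<rightarrow>\<^bsub>H\<^esub> v" by (rule ends_of_edge)
    have ne: "p u \<noteq> p v" using ends[OF e(2)] injp by (auto dest: inj_onD)
    show "{pathstart (\<gamma> e), pathfinish (\<gamma> e)} = p ` e" using pends e by simp
    show "Path_Connected.arc (\<gamma> e)"
    proof -
      have "pathstart (\<gamma> e) \<noteq> pathfinish (\<gamma> e)" using pends[of u v] ne e(1) by auto
      then show ?thesis by (simp add: \<gamma>_def arc_linepath)
    qed
    show "path_image (\<gamma> e) \<inter> p ` verts H = p ` e"
    proof
      show "path_image (\<gamma> e) \<inter> p ` verts H \<subseteq> p ` e"
      proof
        fix z assume "z \<in> path_image (\<gamma> e) \<inter> p ` verts H"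
        then obtain w where w: "w \<in> verts H" "z = p w" "p w \<in> closed_segment (p u) (p v)"
          using image e(1) by auto
        then obtain q where "p w = (1 - q) *\<^sub>R p u + q *\<^sub>R p v" by (auto simp: in_segment)
        then have "chord_side (f u) (f v) (p w) = 0"
          using chord_side_eq_0_iff[of "f u" "f v" "f u"] chord_side_eq_0_iff[of "f u" "f v" "f v"]
          by (simp add: chord_side_convex p_def)
        then have "f w = f u \<or> f w = f v" by (simp add: p_def chord_side_eq_0_iff)
        then show "z \<in> p ` e" using w(2) e(1) by (auto simp: p_def)
      qed
    qed (use image e ends in auto)
  next
    fix e e' assume "e \<in> edges H" "e' \<in> edges H" "e \<noteq> e'"
    then obtain u v u' v' where e: "e = {u, v}" "u \<rightarrow>\<^bsub>H\<^esub> v" "e' = {u', v'}" "u' \<rightarrow>\<^bsub>H\<^esub> v'"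
      by (metis ends_of_edge)
    have "inj_on f {u, v, u', v'}"
      by (rule inj_on_subset[OF inj]) (use ends[OF e(2)] ends[OF e(4)] in auto)
    then have im: "f ` (e \<inter> e') = {f u, f v} \<inter> {f u', f v'}" "{f u, f v} \<noteq> {f u', f v'}"
      using inj_on_image_Int[of f "{u, v, u', v'}" e e']
        inj_on_image_eq_iff[of f "{u, v, u', v'}" e e']
        e \<open>e \<noteq> e'\<close> by auto
    have "path_image (\<gamma> e) \<inter> path_image (\<gamma> e') = circle_point ` ({f u, f v} \<inter> {f u', f v'})"
      using noncrossing_chords_meet_in_endpoints[OF _ im(2) noncross[OF e(2,4)]] ends[OF e(4)]
      by (simp add: e image p_def)
    then show "path_image (\<gamma> e) \<inter> path_image (\<gamma> e') = p ` (e \<inter> e')"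
      by (simp only: p_def image_comp[symmetric] im(1))
  qed
  moreover have "path_image (\<gamma> e) \<subseteq> cball 0 1" for e
    unfolding \<gamma>_def path_image_linepath
    by (intro closed_segment_subset) (auto simp: norm_circle_point)
  moreover have "p ` verts H \<subseteq> sphere 0 1" by (auto simp: p_def norm_circle_point)
  ultimately show ?thesis unfolding outerplanar_embedding_def by blast
qed


section \<open>Cliques on four vertices\<close>

lemma not_outerplanar_embedding_K4:
  assumes "card Q = 4" "Q \<subseteq> verts H" "\<And>u v. u \<in> Q \<Longrightarrow> v \<in> Q \<Longrightarrow> u \<noteq> v \<Longrightarrow> u \<rightarrow>\<^bsub>H\<^esub> v"
  shows "\<not> outerplanar_embedding H p \<gamma>"
proof
  assume "outerplanar_embedding H p \<gamma>"
  then have inj: "inj_on p (verts H)" and sphere: "p ` verts H \<subseteq> sphere 0 1"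
    and arc: "\<And>e. e \<in> edges H \<Longrightarrow> Path_Connected.arc (\<gamma> e)"
      "\<And>e. e \<in> edges H \<Longrightarrow> {pathstart (\<gamma> e), pathfinish (\<gamma> e)} = p ` e"
      "\<And>e. e \<in> edges H \<Longrightarrow> path_image (\<gamma> e) \<subseteq> cball 0 1"
    and disj: "\<And>e f. e \<in> edges H \<Longrightarrow> f \<in> edges H \<Longrightarrow> e \<noteq> f \<Longrightarrow>
      path_image (\<gamma> e) \<inter> path_image (\<gamma> f) = p ` (e \<inter> f)"
    by (auto simp: outerplanar_embedding_def planar_embedding_def)
  have injQ: "inj_on p Q" using inj assms(2) by (rule inj_on_subset)
  have "card (p ` Q) = 4" "p ` Q \<subseteq> sphere 0 1"
    using card_image[OF injQ] assms(1,2) sphere by auto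
  then obtain a b c d where abcd: "distinct [a, b, c, d]" "{a, b, c, d} = p ` Q"
    "closed_segment a c \<inter> closed_segment b d \<noteq> {}"
    by (rule four_points_on_circle_cross)
  have "a \<in> p ` Q" "b \<in> p ` Q" "c \<in> p ` Q" "d \<in> p ` Q" using abcd(2) by auto
  then obtain a' b' c' d' where Q: "a' \<in> Q" "b' \<in> Q" "c' \<in> Q" "d' \<in> Q"
    and p: "a = p a'" "b = p b'" "c = p c'" "d = p d'" by blast
  have dist: "distinct [a', b', c', d']" using abcd(1) p by auto
  have e: "{a', c'} \<in> edges H" "{b', d'} \<in> edges H"
    using assms(3) Q dist by (auto simp: edges_def)
  \<comment> \<open>the drawing of an edge may run in either direction\<close>
  have path: "\<exists>f. path f \<and> pathstart f = p u \<and> pathfinish f = p v \<and>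
      path_image f = path_image (\<gamma> {u, v})"
    if "{u, v} \<in> edges H" for u v
  proof -
    have "path (\<gamma> {u, v})" using arc(1)[OF that] by (rule arc_imp_path)
    moreover have "pathstart (\<gamma> {u, v}) = p u \<and> pathfinish (\<gamma> {u, v}) = p v
      \<or> pathstart (\<gamma> {u, v}) = p v \<and> pathfinish (\<gamma> {u, v}) = p u"
      using arc(2)[OF that] by (auto simp: doubleton_eq_iff)
    ultimately show ?thesis
      by (metis path_image_reversepath path_reversepath pathfinish_reversepath pathstart_reversepath)
  qed
  obtain f where f: "path f" "pathstart f = a" "pathfinish f = c"
    "path_image f = path_image (\<gamma> {a', c'})"
    using path[OF e(1)] p by auto
  obtain g where g: "path g" "pathstart g = b" "pathfinish g = d"
    "path_image g = path_image (\<gamma> {b', d'})"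
    using path[OF e(2)] p by auto
  have "norm z = 1" if "z \<in> p ` Q" for z using that \<open>p ` Q \<subseteq> sphere 0 1\<close> by auto
  then have "norm a = 1" "norm b = 1" "norm c = 1" "norm d = 1" using Q p by auto
  then have "path_image f \<inter> path_image g \<noteq> {}"
    using arcs_with_crossing_chords_meet[OF f(1) _ f(2,3) g(1) _ g(2,3) _ _ _ _ abcd(1,3)]
      arc(3)[OF e(1)] arc(3)[OF e(2)] f(4) g(4) by simp
  moreover have "path_image f \<inter> path_image g = p ` ({a', c'} \<inter> {b', d'})"
    unfolding f(4) g(4) using dist by (intro disj[OF e]) (auto simp: doubleton_eq_iff)
  ultimately show False using dist by auto
qed

lemma four_clique_neither_outerplanar_nor_ring:
  fixes \<Gamma> :: "'a pair_pre_digraph"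
  assumes wf: "wf_digraph (with_proj \<Gamma>)" and Q: "card Q = 4" "Q \<subseteq> pverts \<Gamma>"
    and adj: "\<And>u v. u \<in> Q \<Longrightarrow> v \<in> Q \<Longrightarrow> u \<noteq> v \<Longrightarrow> (u, v) \<in> parcs \<Gamma>"
  shows "\<not> outerplanar (with_proj \<Gamma>)" "\<not> ring_graph (with_proj \<Gamma>)"
proof -
  define H where "H = \<lparr>pverts = Q, parcs = {(u, v). (u, v) \<in> Q \<times> Q \<and> u \<noteq> v}\<rparr>"
  have fin: "finite Q" using Q(1) by (metis card.infinite zero_neq_numeral)
  have K4: "K\<^bsub>4\<^esub> (with_proj H)"
    using fin Q by (simp add: complete_digraph_pair_def H_def)
  then interpret H: pair_graph H by (rule pair_graphI_complete)
  have sub: "subgraph (with_proj H) (with_proj \<Gamma>)"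
    unfolding subgraph_def using wf H.wf_digraph Q(2) adj
    by (auto simp: compatible_def H_def)
  have "\<not> outerplanar_embedding (with_proj H) p \<gamma>" for p \<gamma>
    by (rule not_outerplanar_embedding_K4[OF Q(1)]) (auto simp: H_def)
  then show "\<not> outerplanar (with_proj \<Gamma>)"
    unfolding outerplanar_def using sub fin by (auto simp: H_def)
  have "bidirected_digraph (with_proj H) (swap_in (parcs H))"
    by (rule H.bidirected_digraph)
  then have "subdivision (with_proj H, swap_in (parcs H)) (with_proj H, swap_in (parcs H))"
    by (rule subdivision_base)
  then show "\<not> ring_graph (with_proj \<Gamma>)"
    unfolding ring_graph_def contains_K4_subdivision_def using sub K4 by blast
qed


section \<open>Cycles as periodic sequences\<close>

lemma cas_head_eq_next_tail:
  assumes "pre_digraph.cas G u p w"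
  shows "p \<noteq> [] \<Longrightarrow> tail G (p ! 0) = u"
    and "i < length p \<Longrightarrow> head G (p ! i) = (if Suc i < length p then tail G (p ! Suc i) else w)"
  using assms
proof (induction p arbitrary: u i)
  case Nil
  { case 1 then show ?case by simp }
  { case 2 then show ?case by simp }
next
  case (Cons a p)
  { case 1 then show ?case by (simp add: pre_digraph.cas.simps) }
  { case 2
    then have *: "pre_digraph.cas G (head G a) p w" by (simp add: pre_digraph.cas.simps)
    show ?case
    proof (cases i)
      case 0
      then show ?thesis using Cons.IH(1)[OF _ *] * by (cases p) (auto simp: pre_digraph.cas.simps)
    next
      case (Suc j)
      then show ?thesis using Cons.IH(2)[OF _ *, of j] 2 by simp
    qed }
qed

text \<open>
  A cycle of length \<open>n\<close> is described by the \<open>n\<close>-periodic sequence of its vertices, so that no vertex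
  plays the role of the starting point.
\<close>

lemma cycle_as_periodic_sequence:
  assumes "C \<in> cycles \<Gamma>"
  shows "\<exists>n v. 3 \<le> n \<and> (\<forall>i. v i \<rightarrow>\<^bsub>\<Gamma>\<^esub> v (Suc i)) \<and> (\<forall>i j. v i = v j \<longleftrightarrow> i mod n = j mod n) \<and>
    C = range (\<lambda>i. {v i, v (Suc i)})"
proof -
  obtain p where C: "C = (\<lambda>a. {tail \<Gamma> a, head \<Gamma> a}) ` set p"
    and p: "pre_digraph.cycle \<Gamma> p" and n3: "3 \<le> length p"
    using assms by (auto simp: cycles_def)
  define n where "n = length p"
  have n: "3 \<le> n" "0 < n" using n3 unfolding n_def by linarith+
  obtain u where cas: "pre_digraph.cas \<Gamma> u p u" and arcs: "set p \<subseteq> arcs \<Gamma>"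
    and dist: "distinct (tl (pre_digraph.awalk_verts \<Gamma> u p))"
    using p by (auto simp: pre_digraph.cycle_def pre_digraph.awalk_def)
  have "p \<noteq> []" using n3 by (cases p) simp_all
  then have "distinct (map (head \<Gamma>) p)"
    using dist by (auto simp: pre_digraph.awalk_verts_conv'[OF cas] split: if_splits)
  then have dh: "i = j" if "i < n" "j < n" "head \<Gamma> (p ! i) = head \<Gamma> (p ! j)" for i j
    using that by (auto simp: n_def distinct_conv_nth)
  define v where "v i = tail \<Gamma> (p ! (i mod n))" for i
  have head: "head \<Gamma> (p ! (i mod n)) = v (Suc i)" for i
  proof -
    have "i mod n < length p" using n by (simp add: n_def)
    then have "head \<Gamma> (p ! (i mod n)) =
        (if Suc (i mod n) < n then tail \<Gamma> (p ! Suc (i mod n)) else tail \<Gamma> (p ! 0))"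
      using cas_head_eq_next_tail[OF cas] n by (auto simp: n_def)
    also have "\<dots> = v (Suc i)"
      using \<open>i mod n < length p\<close> by (auto simp: v_def mod_Suc n_def)
    finally show ?thesis .
  qed
  have period: "v (i + n) = v i" for i by (simp add: v_def)
  have eq: "v i = v j \<longleftrightarrow> i mod n = j mod n" for i j
  proof
    assume "v i = v j"
    then have "v (Suc (i + (n - 1))) = v (Suc (j + (n - 1)))"
      using n period[of i] period[of j] by simp
    then have "(i + (n - 1)) mod n = (j + (n - 1)) mod n"
      using n dh unfolding head[symmetric] by simp
    then have "Suc (i + (n - 1)) mod n = Suc (j + (n - 1)) mod n" by (metis mod_Suc_eq)
    then show "i mod n = j mod n" using n by simp
  qed (simp add: v_def)
  have "v i \<rightarrow>\<^bsub>\<Gamma>\<^esub> v (Suc i)" for i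
  proof -
    have "p ! (i mod n) \<in> arcs \<Gamma>" using arcs n by (auto simp: n_def)
    then show ?thesis unfolding head[symmetric] by (auto simp: v_def arcs_ends_conv)
  qed
  moreover have "C = range (\<lambda>i. {v i, v (Suc i)})"
  proof -
    have "set p = range (\<lambda>i. p ! (i mod n))"
    proof
      show "set p \<subseteq> range (\<lambda>i. p ! (i mod n))"
        by (auto simp: in_set_conv_nth n_def) (metis mod_less rangeI)
    qed (use n in \<open>auto simp: n_def\<close>)
    then show ?thesis unfolding C by (simp add: image_image v_def head[unfolded v_def])
  qed
  ultimately show ?thesis using n(1) eq by blast
qed


section \<open>Degrees and connectedness in subdivisions\<close>

lemma subdivision_step_trancl:
  assumes "subdivision_step I rev_I H rev_H (u, v, w) (uv, uw, vw)" "a \<rightarrow>\<^sup>+\<^bsub>I\<^esub> b"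
  shows "a \<rightarrow>\<^sup>+\<^bsub>H\<^esub> b"
proof -
  interpret subdiv_step I rev_I H rev_H u v w uv uw vw using assms(1) by unfold_locales
  have "arcs_ends I \<subseteq> (arcs_ends H)\<^sup>+"
  proof
    fix z assume "z \<in> arcs_ends I"
    then obtain e where e: "e \<in> arcs I" "z = (tail H e, head H e)"
      by (auto simp: arcs_ends_conv tail_eq head_eq)
    show "z \<in> (arcs_ends H)\<^sup>+"
    proof (cases "e \<in> {uv, rev_I uv}")
      case True
      then have "z = (u, v) \<or> z = (v, u)" using e(2) by auto
      then show ?thesis using adj_with_w by (meson trancl.simps)
    next
      case False
      then have "e \<in> arcs H" using e(1) by (auto simp: arcs_H)
      then show ?thesis using e(2) by (auto simp: arcs_ends_conv)
    qed
  qed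
  with assms(2) show ?thesis
    by (induction rule: trancl_induct) (blast intro: trancl_trans)+
qed

lemma subdivision_step_out_degree:
  assumes "subdivision_step I rev_I H rev_H (u, v, w) (uv, uw, vw)" "x \<in> verts I"
  shows "out_degree H x = out_degree I x"
proof -
  interpret subdiv_step I rev_I H rev_H u v w uv uw vw using assms(1) by unfold_locales
  \<comment> \<open>the two halves of a subdivided edge take its place at its two ends\<close>
  define \<phi> where "\<phi> a = (if a = uv then uw else if a = rev_I uv then vw else a)" for a
  have "x \<noteq> w" using assms(2) not_in_verts_G by blast
  have "bij_betw \<phi> (out_arcs I x) (out_arcs H x)"
  proof (rule bij_betw_imageI)
    show "inj_on \<phi> (out_arcs I x)"
      using subdiv_distinct_arcs not_in_arcs_G by (auto simp: inj_on_def \<phi>_def)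
    show "\<phi> ` out_arcs I x = out_arcs H x"
    proof
      show "\<phi> ` out_arcs I x \<subseteq> out_arcs H x"
        using in_arcs_H by (auto simp: \<phi>_def arcs_H tail_eq[symmetric])
      show "out_arcs H x \<subseteq> \<phi> ` out_arcs I x"
      proof
        fix e assume e: "e \<in> out_arcs H x"
        then have eH: "e \<in> arcs H" "tail H e = x" by auto
        consider "e = uw" | "e = vw" | "e \<in> {rev_H uw, rev_H vw}" | "e \<in> arcs I - {uv, rev_I uv}"
          using eH(1) by (auto simp: arcs_H)
        then show "e \<in> \<phi> ` out_arcs I x"
        proof cases
          case 1
          then have "uv \<in> out_arcs I x" "\<phi> uv = e" using eH in_arcs_G by (auto simp: \<phi>_def)
          then show ?thesis by blast
        next
          case 2
          then have "rev_I uv \<in> out_arcs I x" "\<phi> (rev_I uv) = e"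
            using eH in_arcs_G subdiv_distinct_arcs by (auto simp: \<phi>_def)
          then show ?thesis by blast
        next
          case 3
          then show ?thesis using eH \<open>x \<noteq> w\<close> by auto
        next
          case 4
          then have "e \<in> out_arcs I x" "\<phi> e = e" using eH by (auto simp: \<phi>_def tail_eq)
          then show ?thesis by (metis imageI)
        qed
      qed
    qed
  qed
  then show ?thesis unfolding out_degree_def by (simp add: bij_betw_same_card)
qed

text \<open>
  Subdivision keeps the degrees of the original vertices and the connections between them.
\<close>

lemma subdivision_trancl_out_degree:
  assumes "subdivision (K, rev_K) (H, rev_H)"
  shows "(a \<rightarrow>\<^sup>+\<^bsub>K\<^esub> b \<longrightarrow> a \<rightarrow>\<^sup>+\<^bsub>H\<^esub> b) \<and>
    (\<forall>x \<in> verts K. x \<in> verts H \<and> out_degree H x = out_degree K x)"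
  using assms
proof (induction rule: subdivision_induct)
  case (divide I rev_I H rev_H u v w uv uw vw)
  have "verts H = verts I \<union> {w}" using divide.hyps(2) by (simp add: subdivision_step_def)
  then show ?case
    using divide.IH subdivision_step_trancl[OF divide.hyps(2)]
      subdivision_step_out_degree[OF divide.hyps(2)]
    by auto
qed auto

lemma (in nomulti_digraph) inj_on_head_out_arcs:
  "inj_on (head G) (out_arcs G x)"
  by (auto intro!: inj_onI no_multi_arcs simp: arc_to_ends_def)

lemma complete_digraph_out_degree:
  assumes "K\<^bsub>n\<^esub> K" "x \<in> verts K"
  shows "out_degree K x = n - 1"
proof -
  interpret graph K using assms(1) by (simp add: complete_digraph_def)
  have ends: "arcs_ends K = {(u, v). (u, v) \<in> verts K \<times> verts K \<and> u \<noteq> v}"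
    and card: "card (verts K) = n"
    using assms(1) by (auto simp: complete_digraph_def)
  have "head K ` out_arcs K x = {y. x \<rightarrow>\<^bsub>K\<^esub> y}"
    by (auto simp: arcs_ends_conv image_iff)
  also have "\<dots> = verts K - {x}" using ends assms(2) by auto
  finally have "card (out_arcs K x) = card (verts K - {x})"
    using card_image[OF inj_on_head_out_arcs] by metis
  then show ?thesis using assms(2) card by (simp add: out_degree_def)
qed


section \<open>Unions of windmills\<close>

lemma not_in_right_neighbourhood_of_finite:
  fixes t :: real
  assumes "finite A"
  shows "\<exists>e > 0. \<forall>a \<in> A. a \<le> t \<or> t + e < a"
  using assms
proof (induction A)
  case empty
  then show ?case by (auto intro: exI[of _ 1])
next
  case (insert b A)
  then obtain e where e: "0 < e" "\<forall>a \<in> A. a \<le> t \<or> t + e < a" by auto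
  define e' where "e' = (if b \<le> t then e else min e ((b - t) / 2))"
  have "0 < e'" "e' \<le> e" "b \<le> t \<or> t + e' < b" using e(1) by (auto simp: e'_def field_simps min_def)
  then show ?case using e by (intro exI[of _ e']) force
qed

text \<open>
  A disjoint union of windmills: \<open>T\<close> is an independent set of hubs, and any other vertex \<open>x\<close> is adjacent
  to at most its partner \<open>\<sigma> x\<close>, which is no hub either, and the hub \<open>c x\<close>, which \<open>x\<close> shares with its
  partner. The triangles with vertices \<open>x\<close>, \<open>\<sigma> x\<close> and \<open>c x\<close> are the blades of the windmills; some of their
  edges may be missing, \<open>\<sigma> x = x\<close> is possible, and \<open>\<sigma> x\<close> and \<open>c x\<close> need not be vertices of the graph.
\<close>

locale windmill = sym_digraph \<Gamma> + loopfree_digraph \<Gamma> + nomulti_digraph \<Gamma>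
  for \<Gamma> :: "('a, 'b) pre_digraph" +
  fixes T :: "'a set" and \<sigma> c :: "'a \<Rightarrow> 'a"
  assumes hubs_not_adjacent: "u \<in> T \<Longrightarrow> v \<in> T \<Longrightarrow> \<not> u \<rightarrow>\<^bsub>\<Gamma>\<^esub> v"
    and neighbours: "x \<notin> T \<Longrightarrow> x \<rightarrow>\<^bsub>\<Gamma>\<^esub> y \<Longrightarrow> y = \<sigma> x \<or> y = c x"
    and partner: "x \<in> verts \<Gamma> \<Longrightarrow> x \<notin> T \<Longrightarrow> \<sigma> x \<notin> T"
      "x \<in> verts \<Gamma> \<Longrightarrow> x \<notin> T \<Longrightarrow> \<sigma> (\<sigma> x) = x"
      "x \<in> verts \<Gamma> \<Longrightarrow> x \<notin> T \<Longrightarrow> c (\<sigma> x) = c x"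
      "x \<in> verts \<Gamma> \<Longrightarrow> x \<notin> T \<Longrightarrow> c x \<in> T"
begin

text \<open>
  The order is built by inserting one blade at a time: \<open>x\<close> and its partner are placed immediately to the
  right of their hub. No vertex placed before then lies between any two of the three, which is why the
  new edges cross none of the old ones.
\<close>

lemma noncrossing_order:
  assumes "finite S" "S \<subseteq> verts \<Gamma>"
  shows "\<exists>f :: 'a \<Rightarrow> real. inj_on f S \<and>
    (\<forall>a \<in> S. \<forall>b \<in> S. \<forall>u \<in> S. \<forall>v \<in> S. a \<rightarrow>\<^bsub>\<Gamma>\<^esub> b \<longrightarrow> u \<rightarrow>\<^bsub>\<Gamma>\<^esub> v \<longrightarrow>
      0 \<le> ((f u - f a) * (f u - f b)) * ((f v - f a) * (f v - f b)))"
  using assms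
proof (induction "card S" arbitrary: S rule: less_induct)
  case less
  show ?case
  proof (cases "S \<subseteq> T")
    case True
    have "\<exists>f :: 'a \<Rightarrow> real. inj_on f S"
    proof -
      obtain k :: "'a \<Rightarrow> nat" where "inj_on k S"
        using finite_imp_inj_to_nat_seg[OF less.prems(1)] by blast
      then have "inj_on (real \<circ> k) S" by (auto simp: inj_on_def)
      then show ?thesis by blast
    qed
    then show ?thesis using True hubs_not_adjacent by blast
  next
    case False
    then obtain x where x: "x \<in> S" "x \<notin> T" "x \<in> verts \<Gamma>" using less.prems by blast
    define y h where "y = \<sigma> x" and "h = c x"
    define S' where "S' = S - {x, y}"
    have "card S' < card S"
      using x(1) less.prems(1) by (auto simp: S'_def intro!: psubset_card_mono)
    moreover have "finite S'" "S' \<subseteq> verts \<Gamma>" using less.prems by (auto simp: S'_def)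
    ultimately obtain f :: "'a \<Rightarrow> real" where f: "inj_on f S'"
      "\<And>a b u v. a \<in> S' \<Longrightarrow> b \<in> S' \<Longrightarrow> u \<in> S' \<Longrightarrow> v \<in> S' \<Longrightarrow> a \<rightarrow>\<^bsub>\<Gamma>\<^esub> b \<Longrightarrow> u \<rightarrow>\<^bsub>\<Gamma>\<^esub> v \<Longrightarrow>
        0 \<le> ((f u - f a) * (f u - f b)) * ((f v - f a) * (f v - f b))"
      using less.hyps[of S'] by blast
    \<comment> \<open>if \<open>h\<close> is not in \<open>S'\<close> then \<open>f h\<close> is arbitrary, which does no harm\<close>
    obtain \<epsilon> where \<epsilon>: "0 < \<epsilon>" "\<And>z. z \<in> S' \<Longrightarrow> f z \<le> f h \<or> f h + \<epsilon> < f z"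
      using not_in_right_neighbourhood_of_finite[of "f ` S'" "f h"] less.prems(1)
      by (auto simp: S'_def)
    define g where "g = f(x := f h + \<epsilon> / 2, y := f h + \<epsilon>)"
    have yT: "y \<notin> T" and hT: "h \<in> T" using partner x by (auto simp: y_def h_def)
    have gh: "g h = f h" using yT hT x(2) by (auto simp: g_def)
    have gxy: "f h < g x" "g x \<le> f h + \<epsilon>" "f h < g y" "g y \<le> f h + \<epsilon>" "x \<noteq> y \<Longrightarrow> g x \<noteq> g y"
      using \<epsilon>(1) by (auto simp: g_def)
    have gS: "g z = f z" if "z \<in> S'" for z using that by (auto simp: g_def S'_def)
    have inj: "inj_on g S"
    proof (rule inj_onI)
      fix p q assume pq: "p \<in> S" "q \<in> S" "g p = g q"
      consider "p \<in> S'" "q \<in> S'" | "p \<in> S'" "q \<in> {x, y}" | "p \<in> {x, y}" "q \<in> S'"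
        | "p \<in> {x, y}" "q \<in> {x, y}" using pq(1,2) by (auto simp: S'_def)
      then show "p = q"
      proof cases
        case 1
        then show ?thesis using pq(3) gS f(1) by (auto dest: inj_onD)
      next
        case 2
        then show ?thesis using pq(3) gS[of p] \<epsilon>(2)[of p] gxy by auto
      next
        case 3
        then show ?thesis using pq(3) gS[of q] \<epsilon>(2)[of q] gxy by auto
      next
        case 4
        then show ?thesis using pq(3) gxy(5) by (metis insertE singletonD)
      qed
    qed
    have side: "0 \<le> (g z - g p) * (g z - g q)" if "z \<in> S'" "p \<in> {h, x, y}" "q \<in> {h, x, y}" for z p q
    proof (cases "f z \<le> f h")
      case True
      then have "g z - g p \<le> 0" "g z - g q \<le> 0" using that gS[OF that(1)] gh gxy by auto
      then show ?thesis by (rule mult_nonpos_nonpos)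
    next
      case False
      then have "0 \<le> g z - g p" "0 \<le> g z - g q"
        using that gS[OF that(1)] gh gxy \<epsilon>(2)[OF that(1)] \<epsilon>(1) by auto
      then show ?thesis by (rule mult_nonneg_nonneg)
    qed
    have edge: "a \<in> S' \<and> b \<in> S' \<or> a \<in> {h, x, y} \<and> b \<in> {h, x, y}"
      if "a \<in> S" "b \<in> S" "a \<rightarrow>\<^bsub>\<Gamma>\<^esub> b" for a b
    proof -
      have xy: "p \<in> {h, x, y}" if "q \<in> {x, y}" "q \<rightarrow>\<^bsub>\<Gamma>\<^esub> p" for p q
        using that neighbours[of x p] neighbours[of y p] x yT partner[OF x(3,2)]
        by (auto simp: y_def h_def)
      have "b \<rightarrow>\<^bsub>\<Gamma>\<^esub> a" using that(3) arcs_ends_symmetric[OF sym_arcs] by simp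
      then show ?thesis using that xy[of a b] xy[of b a] by (auto simp: S'_def)
    qed
    have noncross: "0 \<le> ((g u - g a) * (g u - g b)) * ((g v - g a) * (g v - g b))"
      if ab: "a \<in> S" "b \<in> S" "a \<rightarrow>\<^bsub>\<Gamma>\<^esub> b" and uv: "u \<in> S" "v \<in> S" "u \<rightarrow>\<^bsub>\<Gamma>\<^esub> v" for a b u v
    proof -
      consider "a \<in> S'" "b \<in> S'" "u \<in> S'" "v \<in> S'"
        | "a \<in> S'" "b \<in> S'" "u \<in> {h, x, y}" "v \<in> {h, x, y}"
        | "a \<in> {h, x, y}" "b \<in> {h, x, y}" "u \<in> S'" "v \<in> S'"
        | "a \<in> {h, x, y}" "b \<in> {h, x, y}" "u \<in> {h, x, y}" "v \<in> {h, x, y}"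
        using edge[OF ab] edge[OF uv] by blast
      then show ?thesis
      proof cases
        case 1
        then show ?thesis using f(2)[of a b u v] ab(3) uv(3) gS by simp
      next
        case 2
        have "0 \<le> ((g a - g u) * (g a - g v)) * ((g b - g u) * (g b - g v))"
          using 2 by (intro mult_nonneg_nonneg[OF side side])
        also have "\<dots> = ((g u - g a) * (g u - g b)) * ((g v - g a) * (g v - g b))" by algebra
        finally show ?thesis .
      next
        case 3
        then show ?thesis by (intro mult_nonneg_nonneg[OF side side])
      next
        case 4
        \<comment> \<open>two edges of one triangle share a vertex, so a factor vanishes\<close>
        have "a \<noteq> b" "u \<noteq> v" using ab(3) uv(3) adj_not_same by blast+
        then have "u = a \<or> u = b \<or> v = a \<or> v = b" using 4 by auto
        then show ?thesis by auto
      qed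
    qed
    then show ?thesis using inj by blast
  qed
qed

text \<open>
  On a cycle through a vertex \<open>x\<close> that is no hub, the neighbours of \<open>x\<close> are \<open>\<sigma> x\<close> and \<open>c x\<close>, and the
  neighbour of \<open>\<sigma> x\<close> other than \<open>x\<close> is \<open>c x\<close>, which closes the cycle.
\<close>

lemma cycle_is_triangle:
  assumes "C \<in> cycles \<Gamma>" "x \<in> \<Union>C" "x \<notin> T"
  shows "C = {{a, b} | a b. {a, b} \<subseteq> {x, \<sigma> x, c x} \<and> a \<noteq> b}"
proof -
  obtain n v where n: "3 \<le> n" and adj: "\<And>i. v i \<rightarrow>\<^bsub>\<Gamma>\<^esub> v (Suc i)"
    and eq: "\<And>i j. v i = v j \<longleftrightarrow> i mod n = j mod n" and C: "C = range (\<lambda>i. {v i, v (Suc i)})"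
    using cycle_as_periodic_sequence[OF assms(1)] by auto
  obtain k' where k': "x = v k'" using assms(2) C by auto
  \<comment> \<open>the shift by a period makes room for the predecessors \<open>k - 1\<close> and \<open>k - 2\<close>\<close>
  define k where "k = k' + n"
  have x: "x = v k" using eq k' by (simp add: k_def)
  have kn: "n \<le> k" by (simp add: k_def)
  have xV: "x \<in> verts \<Gamma>" using adj[of k] x by (auto dest: adj_in_verts)
  have dist: "v (i + j) \<noteq> v i" if "0 < j" "j < n" for i j
    using that by (auto simp: eq mod_eq_iff_dvd_symdiff_nat dest: nat_dvd_not_less)
  have adj': "v (Suc i) \<rightarrow>\<^bsub>\<Gamma>\<^esub> v i" for i using adj arcs_ends_symmetric[OF sym_arcs] by simp
  have pred: "v k \<rightarrow>\<^bsub>\<Gamma>\<^esub> v (k - 1)" "v (k - 1) \<rightarrow>\<^bsub>\<Gamma>\<^esub> v (k - 2)"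
    using adj'[of "k - 1"] adj'[of "k - 2"] kn n by (simp_all add: numeral_2_eq_2 Suc_diff_Suc)
  have "v (k - 1) \<noteq> v (k + 1)" using dist[of 2 "k - 1"] n kn by simp
  then have nb: "{v (k + 1), v (k - 1)} = {\<sigma> x, c x}"
    using neighbours[OF assms(3), of "v (k + 1)"] neighbours[OF assms(3), of "v (k - 1)"]
      adj[of k] pred x by auto
  have n3: "n = 3"
  proof (rule ccontr)
    assume "n \<noteq> 3"
    have sT: "\<sigma> x \<notin> T" "\<sigma> (\<sigma> x) = x" "c (\<sigma> x) = c x" using partner xV assms(3) by auto
    consider "v (k + 1) = \<sigma> x" "v (k - 1) = c x" | "v (k - 1) = \<sigma> x" "v (k + 1) = c x"
      using nb by (auto simp: doubleton_eq_iff)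
    then show False
    proof cases
      case 1
      then have "v (k + 2) = x \<or> v (k + 2) = c x"
        using neighbours[OF sT(1), of "v (k + 2)"] adj[of "k + 1"] sT by simp
      then have "v (k + 2) = v k \<or> v (k - 1 + 3) = v (k - 1)" using 1 x kn n by simp
      then show False using dist[of 2 k] dist[of 3 "k - 1"] n \<open>n \<noteq> 3\<close> by auto
    next
      case 2
      then have "v (k - 2) = x \<or> v (k - 2) = c x"
        using neighbours[OF sT(1), of "v (k - 2)"] pred(2) sT by simp
      moreover have "k - 2 + 2 = k" "k - 2 + 3 = k + 1" using kn n by auto
      ultimately have "v (k - 2 + 2) = v (k - 2) \<or> v (k - 2 + 3) = v (k - 2)" using 2 x by metis
      then show False using dist[of 2 "k - 2"] dist[of 3 "k - 2"] n \<open>n \<noteq> 3\<close> by auto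
    qed
  qed
  have ran: "range v = {v (k - 1), v k, v (k + 1)}"
  proof -
    obtain j where j: "k = Suc j" using kn n by (cases k) auto
    have "i mod 3 = j mod 3 \<or> i mod 3 = Suc j mod 3 \<or> i mod 3 = Suc (Suc j) mod 3" for i
    proof -
      have "i mod 3 < 3" "j mod 3 < 3" by simp_all
      then show ?thesis unfolding mod_Suc by (simp split: if_split) linarith
    qed
    then have "v i \<in> {v (k - 1), v k, v (k + 1)}" for i by (simp add: eq n3 j)
    then show ?thesis by blast
  qed
  also have "\<dots> = insert x {v (k + 1), v (k - 1)}" unfolding x by blast
  finally have ran': "range v = {x, \<sigma> x, c x}" unfolding nb .
  have "C = {{a, b} | a b. {a, b} \<subseteq> range v \<and> a \<noteq> b}"
  proof
    show "C \<subseteq> {{a, b} | a b. {a, b} \<subseteq> range v \<and> a \<noteq> b}"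
    proof
      fix e assume "e \<in> C"
      then obtain i where "e = {v i, v (Suc i)}" unfolding C by blast
      moreover have "v (Suc i) \<noteq> v i" using dist[of 1 i] n by simp
      ultimately show "e \<in> {{a, b} | a b. {a, b} \<subseteq> range v \<and> a \<noteq> b}" by fastforce
    qed
    show "{{a, b} | a b. {a, b} \<subseteq> range v \<and> a \<noteq> b} \<subseteq> C"
    proof
      fix e assume "e \<in> {{a, b} | a b. {a, b} \<subseteq> range v \<and> a \<noteq> b}"
      then obtain i j where e: "e = {v i, v j}" "v i \<noteq> v j" by auto
      then have "i mod 3 \<noteq> j mod 3" by (simp add: eq n3)
      moreover have "i mod 3 < 3" "j mod 3 < 3" by simp_all
      ultimately have "Suc i mod 3 = j mod 3 \<or> Suc j mod 3 = i mod 3"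
        unfolding mod_Suc by (simp split: if_split) linarith
      then have "v (Suc i) = v j \<or> v (Suc j) = v i" by (simp add: eq n3)
      then have "e = {v i, v (Suc i)} \<or> e = {v j, v (Suc j)}" using e(1) by auto
      then show "e \<in> C" unfolding C by blast
    qed
  qed
  then show ?thesis using ran' by simp
qed

lemma primitive_cycle_property: "primitive_cycle_property \<Gamma>"
  unfolding primitive_cycle_property_def
proof (intro ballI impI)
  fix C D assume CD: "C \<in> primitive_cycles \<Gamma>" "D \<in> primitive_cycles \<Gamma>" "C \<noteq> D"
  then have cyc: "C \<in> cycles \<Gamma>" "D \<in> cycles \<Gamma>" by (auto simp: primitive_cycles_def)
  have "C \<inter> D = {}"
  proof (rule ccontr)
    assume "C \<inter> D \<noteq> {}"
    then obtain e where e: "e \<in> C" "e \<in> D" by blast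
    obtain v where "\<forall>i :: nat. v i \<rightarrow>\<^bsub>\<Gamma>\<^esub> v (Suc i)" "C = range (\<lambda>i. {v i, v (Suc i)})"
      using cycle_as_periodic_sequence[OF cyc(1)] by auto
    then obtain u v where "e = {u, v}" "u \<rightarrow>\<^bsub>\<Gamma>\<^esub> v" using e(1) by blast
    then obtain x where "x \<in> e" "x \<notin> T" using hubs_not_adjacent by blast
    then have "x \<in> \<Union>C" "x \<in> \<Union>D" using e by auto
    then have "C = D"
      using cycle_is_triangle[OF cyc(1) _ \<open>x \<notin> T\<close>] cycle_is_triangle[OF cyc(2) _ \<open>x \<notin> T\<close>]
      by metis
    then show False using CD(3) by simp
  qed
  then show "card (C \<inter> D) \<le> 1" by simp
qed

text \<open>
  Every connected component has at most one hub.
\<close>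

lemma hub_of_reachable:
  assumes "u \<rightarrow>\<^sup>+\<^bsub>\<Gamma>\<^esub> v"
  shows "(if u \<in> T then u else c u) = (if v \<in> T then v else c v)"
  using assms
proof (induction rule: trancl_induct)
  have adj: "(if u \<in> T then u else c u) = (if v \<in> T then v else c v)" if uv: "u \<rightarrow>\<^bsub>\<Gamma>\<^esub> v" for u v
  proof -
    have vu: "v \<rightarrow>\<^bsub>\<Gamma>\<^esub> u" using uv arcs_ends_symmetric[OF sym_arcs] by simp
    have V: "u \<in> verts \<Gamma>" "v \<in> verts \<Gamma>" using uv by (auto dest: adj_in_verts)
    show ?thesis
      using hubs_not_adjacent[of u v] uv neighbours[OF _ uv] neighbours[OF _ vu]
        partner[OF V(1)] partner[OF V(2)] by (cases "u \<in> T"; cases "v \<in> T") metis+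
  qed
  {
    case (base y)
    then show ?case by (rule adj)
  next
    case (step y z)
    then show ?case using adj[of y z] by simp
  }
qed

text \<open>
  The branch vertices of a subdivision of the complete graph on 4 vertices have degree 3, so they are
  hubs; but they are connected to each other.
\<close>

lemma no_K4_subdivision: "\<not> contains_K4_subdivision \<Gamma>"
proof
  assume "contains_K4_subdivision \<Gamma>"
  then obtain H K rev_K rev_H where H: "subgraph H \<Gamma>"
    and sd: "subdivision (K, rev_K) (H, rev_H)" and K: "K\<^bsub>4\<^esub> K"
    unfolding contains_K4_subdivision_def by blast
  have HG: "arcs H \<subseteq> arcs \<Gamma>" "verts H \<subseteq> verts \<Gamma>" "tail H = tail \<Gamma>" "head H = head \<Gamma>"
    using H by (auto simp: subgraph_def compatible_def)
  have branch: "x \<in> T" if "x \<in> verts K" for x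
  proof (rule ccontr)
    assume "x \<notin> T"
    have "out_degree H x = 3"
      using subdivision_trancl_out_degree[OF sd] complete_digraph_out_degree[OF K that] that by auto
    moreover have "out_degree H x \<le> 2"
    proof -
      have sub: "out_arcs H x \<subseteq> out_arcs \<Gamma> x" using HG by auto
      have "head \<Gamma> ` out_arcs H x \<subseteq> {\<sigma> x, c x}"
      proof
        fix y assume "y \<in> head \<Gamma> ` out_arcs H x"
        then have "x \<rightarrow>\<^bsub>\<Gamma>\<^esub> y" using sub by (force simp: arcs_ends_conv)
        then show "y \<in> {\<sigma> x, c x}" using neighbours[OF \<open>x \<notin> T\<close>] by simp
      qed
      then have "card (head \<Gamma> ` out_arcs H x) \<le> card {\<sigma> x, c x}" by (intro card_mono) auto
      also have "\<dots> \<le> 2" by (simp add: card_insert_if)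
      finally show ?thesis
        unfolding out_degree_def
        by (subst (asm) card_image) (auto intro: inj_on_subset[OF inj_on_head_out_arcs sub])
    qed
    ultimately show False by simp
  qed
  have "2 \<le> card (verts K)" using K by (simp add: complete_digraph_def)
  then obtain A where "A \<subseteq> verts K" "card A = 2" by (rule obtain_subset_with_card_n)
  then obtain a b where ab: "a \<in> verts K" "b \<in> verts K" "a \<noteq> b" by (auto simp: card_2_iff)
  then have "a \<rightarrow>\<^sup>+\<^bsub>K\<^esub> b" using K by (auto simp: complete_digraph_def)
  then have "a \<rightarrow>\<^sup>+\<^bsub>H\<^esub> b" using subdivision_trancl_out_degree[OF sd] by blast
  moreover have "arcs_ends H \<subseteq> arcs_ends \<Gamma>" using HG by (auto simp: arcs_ends_conv)
  ultimately have "a \<rightarrow>\<^sup>+\<^bsub>\<Gamma>\<^esub> b" by (meson trancl_mono_subset subsetD)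
  then have "a = b" using hub_of_reachable[of a b] branch[OF ab(1)] branch[OF ab(2)] by simp
  then show False using ab(3) by simp
qed

lemma ring_graph: "ring_graph \<Gamma>"
  using primitive_cycle_property no_K4_subdivision by (simp add: ring_graph_def)

lemma outerplanar: "outerplanar \<Gamma>"
  unfolding outerplanar_def
proof (intro allI impI, elim conjE)
  fix H assume H: "subgraph H \<Gamma>" and fin: "finite (verts H)"
  have wf: "wf_digraph H" and V: "verts H \<subseteq> verts \<Gamma>" using H by (auto simp: subgraph_def)
  have E: "u \<rightarrow>\<^bsub>\<Gamma>\<^esub> v" if "u \<rightarrow>\<^bsub>H\<^esub> v" for u v
    using that H by (auto simp: subgraph_def compatible_def arcs_ends_conv)
  obtain f :: "'a \<Rightarrow> real" where f: "inj_on f (verts H)"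
    "\<And>a b u v. a \<in> verts H \<Longrightarrow> b \<in> verts H \<Longrightarrow> u \<in> verts H \<Longrightarrow> v \<in> verts H \<Longrightarrow>
      a \<rightarrow>\<^bsub>\<Gamma>\<^esub> b \<Longrightarrow> u \<rightarrow>\<^bsub>\<Gamma>\<^esub> v \<Longrightarrow> 0 \<le> ((f u - f a) * (f u - f b)) * ((f v - f a) * (f v - f b))"
    using noncrossing_order[OF fin V] by blast
  show "\<exists>p \<gamma>. outerplanar_embedding H p \<gamma>"
  proof (rule outerplanar_embedding_of_noncrossing_order[OF wf _ f(1)])
    show "\<not> u \<rightarrow>\<^bsub>H\<^esub> u" for u using E adj_not_same by blast
    show "0 \<le> ((f u - f a) * (f u - f b)) * ((f v - f a) * (f v - f b))"
      if "a \<rightarrow>\<^bsub>H\<^esub> b" "u \<rightarrow>\<^bsub>H\<^esub> v" for a b u v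
      using that E[OF that(1)] E[OF that(2)] wf_digraph.adj_in_verts[OF wf that(1)]
        wf_digraph.adj_in_verts[OF wf that(2)] by (intro f(2)) auto
  qed
qed

end


section \<open>Power graphs of groups\<close>

context group begin

lemma mem_generate_singleton_iff:
  assumes "x \<in> carrier G"
  shows "y \<in> generate G {x} \<longleftrightarrow> (\<exists>k :: int. y = x [^] k)"
  using generate_pow[OF assms] by auto

lemma int_pow_mod_of_pow_eq_one:
  assumes "x \<in> carrier G" "x [^] (n :: int) = \<one>"
  shows "x [^] k = x [^] (k mod n)"
proof -
  have "x [^] k = x [^] (n * (k div n) + k mod n)" by simp
  also have "\<dots> = (x [^] n) [^] (k div n) \<otimes> x [^] (k mod n)"
    using assms(1) by (simp only: int_pow_mult int_pow_pow)
  finally show ?thesis using assms by simp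
qed

lemma int_pow_eq_imp_pow_diff:
  assumes "x \<in> carrier G" "x [^] i = x [^] (j :: int)"
  shows "x [^] (i - j) = \<one>"
  using assms by (simp add: int_pow_diff)

lemma generate_singleton_cases:
  assumes x: "x \<in> carrier G" and y: "y \<in> generate G {x}"
  shows "x [^] (2::int) = \<one> \<Longrightarrow> y = \<one> \<or> y = x"
    and "x [^] (3::int) = \<one> \<Longrightarrow> y = \<one> \<or> y = x \<or> y = inv x"
    and "x [^] (4::int) = \<one> \<Longrightarrow> y = \<one> \<or> y = x \<or> y = inv x \<or> y = x [^] (2::int)"
proof -
  obtain k :: int where k: "y = x [^] k" using y mem_generate_singleton_iff[OF x] by blast
  have m1: "inv x = x [^] (-1 :: int)" using x by (simp add: int_pow_neg)
  {
    assume *: "x [^] (2::int) = \<one>"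
    then have "y = x [^] (k mod 2)" using int_pow_mod_of_pow_eq_one[OF x *] k by blast
    moreover have "k mod 2 = 0 \<or> k mod 2 = 1" by presburger
    ultimately show "y = \<one> \<or> y = x" using x by auto
  next
    assume *: "x [^] (3::int) = \<one>"
    then have "y = x [^] (k mod 3)" using int_pow_mod_of_pow_eq_one[OF x *] k by blast
    moreover have "inv x = x [^] (2::int)"
      using int_pow_mod_of_pow_eq_one[OF x *, of "-1"] m1 by simp
    moreover have "k mod 3 = 0 \<or> k mod 3 = 1 \<or> k mod 3 = 2" by presburger
    ultimately show "y = \<one> \<or> y = x \<or> y = inv x" using x by auto
  next
    assume *: "x [^] (4::int) = \<one>"
    then have "y = x [^] (k mod 4)" using int_pow_mod_of_pow_eq_one[OF x *] k by blast
    moreover have "inv x = x [^] (3::int)"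
      using int_pow_mod_of_pow_eq_one[OF x *, of "-1"] m1 by simp
    moreover have "k mod 4 = 0 \<or> k mod 4 = 1 \<or> k mod 4 = 2 \<or> k mod 4 = 3" by presburger
    ultimately show "y = \<one> \<or> y = x \<or> y = inv x \<or> y = x [^] (2::int)" using x by auto
  }
qed

text \<open>Adjacency in the power graph.\<close>

abbreviation "power_adjacent x y \<equiv> x \<noteq> y \<and> (x \<in> generate G {y} \<or> y \<in> generate G {x})"

lemma powers_adjacent:
  assumes "x \<in> carrier G" "i dvd j \<or> j dvd i" "x [^] i \<noteq> x [^] (j :: int)"
  shows "power_adjacent (x [^] i) (x [^] j)"
proof -
  have "x [^] j \<in> generate G {x [^] i}" if "i dvd j" for i j :: int
    using that assms(1) by (auto simp: mem_generate_singleton_iff dvd_def int_pow_pow)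
  then show ?thesis using assms(2,3) by blast
qed

lemma distinct_powers:
  fixes I :: "int set"
  assumes x: "x \<in> carrier G" and "\<And>k. 1 \<le> k \<Longrightarrow> k \<le> m \<Longrightarrow> x [^] k \<noteq> \<one>" and "I \<subseteq> {l..l + m}"
  shows "inj_on (\<lambda>k. x [^] k) I"
proof (rule linorder_inj_onI')
  fix i j assume "i \<in> I" "j \<in> I" "i < j"
  moreover from this have "i \<in> {l..l + m}" "j \<in> {l..l + m}" using assms(3) by blast+
  ultimately have "x [^] (j - i) \<noteq> \<one>" by (intro assms(2)) auto
  then show "x [^] i \<noteq> x [^] j" using int_pow_eq_imp_pow_diff[OF x, of j i] by auto
qed

lemma power_graph_eq:
  "power_graph G = with_proj \<lparr>pverts = carrier G,
     parcs = {(x, y). x \<in> carrier G \<and> y \<in> carrier G \<and> power_adjacent x y}\<rparr>"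
  unfolding power_graph_def by (rule arg_cong[of _ _ with_proj]) auto

lemma proper_power_graph_eq:
  "proper_power_graph G = with_proj \<lparr>pverts = carrier G - {\<one>},
     parcs = {(x, y). x \<in> carrier G - {\<one>} \<and> y \<in> carrier G - {\<one>} \<and> power_adjacent x y}\<rparr>"
  by (auto simp: proper_power_graph_def power_graph_def pre_digraph.del_vert_def with_proj_def)

text \<open>
  If \<open>x\<close> has infinite order or order at least 4, then \<open>inv x\<close>, \<open>1\<close>, \<open>x\<close> and \<open>x\<^sup>2\<close> form a clique. If its order
  is not below 5 either, then so do \<open>inv (x\<^sup>2)\<close>, \<open>inv x\<close>, \<open>x\<close> and \<open>x\<^sup>2\<close>, and none of them is the identity.
\<close>

lemma power_graph_neither_outerplanar_nor_ring:
  assumes x: "x \<in> carrier G" and "\<And>k :: int. 1 \<le> k \<Longrightarrow> k \<le> 3 \<Longrightarrow> x [^] k \<noteq> \<one>"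
  shows "\<not> outerplanar (power_graph G)" "\<not> ring_graph (power_graph G)"
proof -
  let ?I = "{-1, 0, 1, 2 :: int}"
  let ?Q = "(\<lambda>k. x [^] k) ` ?I"
  have inj: "inj_on (\<lambda>k. x [^] k) ?I"
    using x assms(2) by (rule distinct_powers[of _ 3 _ "-1"]) auto
  have card: "card ?Q = 4" using card_image[OF inj] by simp
  have dvd: "i dvd j \<or> j dvd i" if "i \<in> ?I" "j \<in> ?I" for i j using that by auto
  have adj: "power_adjacent u v" if uv: "u \<in> ?Q" "v \<in> ?Q" "u \<noteq> v" for u v
  proof -
    obtain i j where "i \<in> ?I" "j \<in> ?I" "u = x [^] i" "v = x [^] j" using uv by blast
    then show ?thesis using powers_adjacent[OF x dvd] uv(3) by blast
  qed
  have "wf_digraph (power_graph G)"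
    using simple_graph_power_graph(1) by (rule sym_digraph.axioms(1))
  then show "\<not> outerplanar (power_graph G)" "\<not> ring_graph (power_graph G)"
    unfolding power_graph_eq
    by (rule four_clique_neither_outerplanar_nor_ring[OF _ card]; use adj x in auto)+
qed

lemma proper_power_graph_neither_outerplanar_nor_ring:
  assumes x: "x \<in> carrier G" and *: "\<And>k :: int. 1 \<le> k \<Longrightarrow> k \<le> 4 \<Longrightarrow> x [^] k \<noteq> \<one>"
  shows "\<not> outerplanar (proper_power_graph G)" "\<not> ring_graph (proper_power_graph G)"
proof -
  let ?I = "{-2, -1, 1, 2 :: int}"
  let ?Q = "(\<lambda>k. x [^] k) ` ?I"
  \<comment> \<open>the exponent 0 is included to see that none of these powers is the identity\<close>
  have inj: "inj_on (\<lambda>k. x [^] k) (insert 0 ?I)"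
    using x * by (rule distinct_powers[of _ 4 _ "-2"]) auto
  then have "inj_on (\<lambda>k. x [^] k) ?I" by (rule inj_on_subset) auto
  then have card: "card ?Q = 4" by (simp add: card_image)
  have ne: "u \<noteq> \<one>" if u: "u \<in> ?Q" for u
  proof -
    obtain i where i: "i \<in> ?I" "u = x [^] i" using u by blast
    then show ?thesis using inj_onD[OF inj, of i 0] by auto
  qed
  have dvd: "i dvd j \<or> j dvd i" if "i \<in> ?I" "j \<in> ?I" for i j using that by auto
  have adj: "power_adjacent u v" if uv: "u \<in> ?Q" "v \<in> ?Q" "u \<noteq> v" for u v
  proof -
    obtain i j where "i \<in> ?I" "j \<in> ?I" "u = x [^] i" "v = x [^] j" using uv by blast
    then show ?thesis using powers_adjacent[OF x dvd] uv(3) by blast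
  qed
  have Q: "?Q \<subseteq> carrier G - {\<one>}" using ne x by auto
  have "wf_digraph (proper_power_graph G)"
    using simple_graph_proper_power_graph(1) by (rule sym_digraph.axioms(1))
  then show "\<not> outerplanar (proper_power_graph G)" "\<not> ring_graph (proper_power_graph G)"
    unfolding proper_power_graph_eq
    by (rule four_clique_neither_outerplanar_nor_ring[OF _ card]; use adj Q in auto)+
qed

text \<open>
  If all orders are at most 3, the power graph is a single windmill with the identity as its hub.
\<close>

lemma windmill_power_graph:
  assumes "\<And>x. x \<in> carrier G \<Longrightarrow> x [^] (2::int) = \<one> \<or> x [^] (3::int) = \<one>"
  shows "windmill (power_graph G) {\<one>} (m_inv G) (\<lambda>x. \<one>)"
proof -
  have gen: "y = \<one> \<or> y = x \<or> y = inv x" if "x \<in> carrier G" "y \<in> generate G {x}" for x y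
    using generate_singleton_cases[OF that] assms[OF that(1)] by blast
  interpret sym_digraph "power_graph G" by (rule simple_graph_power_graph)
  interpret loopfree_digraph "power_graph G" by (rule simple_graph_power_graph)
  interpret nomulti_digraph "power_graph G" by (rule simple_graph_power_graph)
  show ?thesis
  proof unfold_locales
    fix x y assume "x \<notin> {\<one>}" "x \<rightarrow>\<^bsub>power_graph G\<^esub> y"
    then have xy: "x \<in> carrier G" "y \<in> carrier G" "x \<noteq> \<one>" "power_adjacent x y"
      by (auto simp: power_graph_eq)
    then have "y = \<one> \<or> y = inv x \<or> x = inv y" using gen[of x y] gen[of y x] by auto
    then show "y = inv x \<or> y = \<one>" using xy by auto
  qed (auto simp: power_graph_eq)
qed

text \<open>
  If all orders are at most 4, the hubs of the proper power graph are the involutions, and each element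
  of order 4 has its square as its hub. The sixth power is the square for elements of order 4 and the
  identity, which has been deleted, for elements of order 3; unlike the square, it is the same for an
  element of order 3 and its inverse, as the locale demands.
\<close>

lemma windmill_proper_power_graph:
  assumes small: "\<And>x. x \<in> carrier G \<Longrightarrow> x [^] (3::int) = \<one> \<or> x [^] (4::int) = \<one>"
  shows "windmill (proper_power_graph G) {x \<in> carrier G. x [^] (2::int) = \<one>} (m_inv G)
    (\<lambda>x. x [^] (6::int))"
proof -
  have sq2: "(x [^] (2::int)) [^] (2::int) = x [^] (4::int)" if "x \<in> carrier G" for x
    using that by (simp add: int_pow_pow)
  have p6: "x [^] (4::int) = \<one> \<Longrightarrow> x [^] (6::int) = x [^] (2::int)"
    and p3: "x [^] (3::int) = \<one> \<Longrightarrow> inv x = x [^] (2::int)" if "x \<in> carrier G" for x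
    using int_pow_mod_of_pow_eq_one[OF that, of 4 6] int_pow_mod_of_pow_eq_one[OF that, of 3 "-1"]
      that by (simp_all add: int_pow_neg)
  have p12: "x [^] (12::int) = \<one>" if "x \<in> carrier G" for x
    using small[OF that] int_pow_mod_of_pow_eq_one[OF that, of 3 12]
      int_pow_mod_of_pow_eq_one[OF that, of 4 12] by auto
  have inv_pow: "inv x [^] k = x [^] (- k)" if "x \<in> carrier G" for x and k :: int
    using that by (simp add: int_pow_inv int_pow_neg)
  have gen: "y = \<one> \<or> y = x \<or> y = inv x \<or> y = x [^] (2::int)"
    if "x \<in> carrier G" "y \<in> generate G {x}" for x y
    using generate_singleton_cases[OF that] small[OF that(1)] by blast
  let ?\<Gamma> = "proper_power_graph G"
  have adj: "x \<rightarrow>\<^bsub>?\<Gamma>\<^esub> y \<longleftrightarrow>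
      x \<in> carrier G \<and> x \<noteq> \<one> \<and> y \<in> carrier G \<and> y \<noteq> \<one> \<and> power_adjacent x y" for x y
    by (auto simp: proper_power_graph_eq)
  interpret sym_digraph ?\<Gamma> by (rule simple_graph_proper_power_graph)
  interpret loopfree_digraph ?\<Gamma> by (rule simple_graph_proper_power_graph)
  interpret nomulti_digraph ?\<Gamma> by (rule simple_graph_proper_power_graph)
  show ?thesis
  proof unfold_locales
    fix u v
    assume "u \<in> {x \<in> carrier G. x [^] (2::int) = \<one>}" "v \<in> {x \<in> carrier G. x [^] (2::int) = \<one>}"
    then show "\<not> u \<rightarrow>\<^bsub>?\<Gamma>\<^esub> v"
      using generate_singleton_cases(1)[of u v] generate_singleton_cases(1)[of v u]
      unfolding adj by blast
  next
    fix x y assume "x \<notin> {x \<in> carrier G. x [^] (2::int) = \<one>}" "x \<rightarrow>\<^bsub>?\<Gamma>\<^esub> y"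
    then have xy: "x \<in> carrier G" "x [^] (2::int) \<noteq> \<one>" "y \<in> carrier G" "y \<noteq> \<one>" "x \<noteq> \<one>"
      "power_adjacent x y"
      by (auto simp: adj)
    then consider "y = inv x" | "x = inv y" | "y = x [^] (2::int)" | "x = y [^] (2::int)"
      using gen[of x y] gen[of y x] by blast
    then show "y = inv x \<or> y = x [^] (6::int)"
    proof cases
      case 2
      then show ?thesis using xy by simp
    next
      case 3
      then show ?thesis using small[OF xy(1)] p6[OF xy(1)] p3[OF xy(1)] by auto
    next
      case 4
      \<comment> \<open>as \<open>x\<close> is no involution, \<open>y\<close> has order 3 and its square is its inverse\<close>
      then have "y [^] (4::int) \<noteq> \<one>" using xy sq2 by metis
      then have "x = inv y" using small[OF xy(3)] p3[OF xy(3)] 4 by auto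
      then show ?thesis using xy by simp
    qed simp
  next
    fix x assume "x \<in> verts ?\<Gamma>" "x \<notin> {x \<in> carrier G. x [^] (2::int) = \<one>}"
    then have x: "x \<in> carrier G" "x [^] (2::int) \<noteq> \<one>" by (auto simp: proper_power_graph_eq)
    show "inv x \<notin> {x \<in> carrier G. x [^] (2::int) = \<one>}"
      using x by (simp add: inv_pow) (simp add: int_pow_neg inv_eq_1_iff)
    show "inv (inv x) = x" using x by simp
    show "inv x [^] (6::int) = x [^] (6::int)"
      using x int_pow_mod_of_pow_eq_one[OF x(1) p12[OF x(1)], of "-6"] by (simp add: inv_pow)
    show "x [^] (6::int) \<in> {x \<in> carrier G. x [^] (2::int) = \<one>}"
      using x p12 by (simp add: int_pow_pow)
  qed
qed

lemma outerplanar_iff_ring_graph_power_graph: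
  "outerplanar (power_graph G) \<longleftrightarrow> ring_graph (power_graph G)"
proof (cases "\<exists>x \<in> carrier G. x [^] (2::int) \<noteq> \<one> \<and> x [^] (3::int) \<noteq> \<one>")
  case True
  then obtain x where x: "x \<in> carrier G" "x [^] (2::int) \<noteq> \<one>" "x [^] (3::int) \<noteq> \<one>" by blast
  have "x [^] k \<noteq> \<one>" if k: "1 \<le> k" "k \<le> 3" for k :: int
  proof -
    have "k = 1 \<or> k = 2 \<or> k = 3" using k by presburger
    then show ?thesis using x by auto
  qed
  then show ?thesis using power_graph_neither_outerplanar_nor_ring[OF x(1)] by blast
next
  case False
  then interpret windmill "power_graph G" "{\<one>}" "m_inv G" "\<lambda>x. \<one>"
    by (intro windmill_power_graph) blast
  show ?thesis using outerplanar ring_graph by simp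
qed

lemma outerplanar_iff_ring_graph_proper_power_graph:
  "outerplanar (proper_power_graph G) \<longleftrightarrow> ring_graph (proper_power_graph G)"
proof (cases "\<exists>x \<in> carrier G. x [^] (3::int) \<noteq> \<one> \<and> x [^] (4::int) \<noteq> \<one>")
  case True
  then obtain x where x: "x \<in> carrier G" "x [^] (3::int) \<noteq> \<one>" "x [^] (4::int) \<noteq> \<one>" by blast
  have "x [^] k \<noteq> \<one>" if k: "1 \<le> k" "k \<le> 4" for k :: int
  proof
    assume 0: "x [^] k = \<one>"
    have "k = 1 \<or> k = 2 \<or> k = 3 \<or> k = 4" using k by presburger
    then have "k dvd 3 \<or> k dvd 4" by auto
    then show False
      using x int_pow_mod_of_pow_eq_one[OF x(1) 0, of 3] int_pow_mod_of_pow_eq_one[OF x(1) 0, of 4]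
      by auto
  qed
  then show ?thesis using proper_power_graph_neither_outerplanar_nor_ring[OF x(1)] by blast
next
  case False
  then interpret windmill "proper_power_graph G" "{x \<in> carrier G. x [^] (2::int) = \<one>}" "m_inv G"
    "\<lambda>x. x [^] (6::int)"
    by (intro windmill_proper_power_graph) blast
  show ?thesis using outerplanar ring_graph by simp
qed

end

theorem corollary2p5:
  fixes G :: "('a, 'm) monoid_scheme"
  assumes "group G"
  shows "(outerplanar (power_graph G) \<longleftrightarrow> ring_graph (power_graph G)) \<and>
         (outerplanar (proper_power_graph G) \<longleftrightarrow> ring_graph (proper_power_graph G))"
  using group.outerplanar_iff_ring_graph_power_graph[OF assms]
    group.outerplanar_iff_ring_graph_proper_power_graph[OF assms] by blast

end
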